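(* Let $H$ be a separable, infinite dimensional Hilbert space and let $S$ be a countable subset of $H$. Then the set of operators $A \in [B(H)]^+_1$ for which every nonzero vector in the (linear) span of $S$ is cyclic is comeager in $[B(H)]^+_1$ with respect to the relative strong operator topology.
   Context: The scalar field is $\mathbf{R}$ or $\mathbf{C}$. $B(H)$ is the set of bounded linear operators $A : H \to H$, and $[B(H)]_1$ is its closed unit ball for the operator norm. $[B(H)]^+_1$ denotes the set of positive operators in $[B(H)]_1$, i.e. the self-adjoint operators $A$ with $0 \le \langle Av, v\rangle \le 1$ for all $v \in H$ with $\|v\| \le 1$. The strong operator topology on $B(H)$ is the topology generated by the basic open sets $\{A \in B(H) : \|A|_E - B\| < \epsilon\}$, where $\epsilon > 0$, $E$ is a finite dimensional subspace of $H$, and $B : E \to H$ is a linear map; $[B(H)]^+_1$ carries the relative (subspace) topology, for which it is a Polish space. A subset is comeager if it contains a countable intersection of dense open sets. A vector $v \in H$ is cyclic for $A \in B(H)$ if the linear span of $\{A^n v : n \in \mathbf{N}\}$ (with $n \ge 0$, $A^0 v = v$) is dense in $H$. *)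

theory Defs
  imports "HOL-Analysis.Analysis"
begin

text \<open>The models of this class are exactly the reals and the complex numbers with their usual
  conjugation: a finite-dimensional real normed field is one of these two, and \<open>mult_cnjg\<close>
  determines \<open>cnjg\<close>. The norm is the one of \<open>real_normed_field\<close> (the absolute value).\<close>

class real_or_complex = real_normed_field + euclidean_space +
  fixes cnjg :: "'a \<Rightarrow> 'a"
  assumes cnjg_add: "cnjg (x + y) = cnjg x + cnjg y"
    and mult_cnjg: "x * cnjg x = (norm x)\<^sup>2 *\<^sub>R 1"

instantiation real :: real_or_complex
begin
definition cnjg_real :: "real \<Rightarrow> real" where "cnjg_real x = x"
instance by standard (simp_all add: cnjg_real_def power2_eq_square)
end

instantiation complex :: real_or_complex
begin
definition cnjg_complex :: "complex \<Rightarrow> complex" where "cnjg_complex = cnj"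
instance by standard (simp_all add: cnjg_complex_def complex_norm_square[symmetric] scaleR_conv_of_real del: of_real_power)
end

text \<open>A Hilbert space over the scalar field \<^typ>\<open>'k\<close>. The underlying real normed structure and
  completeness come from the class \<^class>\<open>banach\<close>; \<open>scale_of_real\<close> and \<open>ip_self\<close> say that the
  \<^typ>\<open>'k\<close>-structure induces this real structure and this norm.\<close>

locale hilbert_space = vector_space scale
  for scale :: "'k::real_or_complex \<Rightarrow> 'h::banach \<Rightarrow> 'h" +
  fixes ip :: "'h \<Rightarrow> 'h \<Rightarrow> 'k"
  assumes scale_of_real: "scale (of_real r) x = r *\<^sub>R x"
    and ip_add_left: "ip (x + y) z = ip x z + ip y z"
    and ip_scale_left: "ip (scale c x) y = c * ip x y"
    and ip_cnjg: "ip y x = cnjg (ip x y)"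
    and ip_self: "ip x x = of_real ((norm x)\<^sup>2)"
begin

definition finite_dim :: "'h set \<Rightarrow> bool" where
  "finite_dim E \<longleftrightarrow> (\<exists>F. finite F \<and> span F = E)"

text \<open>\<^typ>\<open>'h \<Rightarrow>\<^sub>L 'h\<close> consists of the real-linear bounded operators, so linearity over
  \<^typ>\<open>'k\<close> has to be required.\<close>

definition bounded_ops :: "('h \<Rightarrow>\<^sub>L 'h) set" where
  "bounded_ops = {A. \<forall>c x. blinfun_apply A (scale c x) = scale c (blinfun_apply A x)}"

definition self_adjoint :: "('h \<Rightarrow>\<^sub>L 'h) \<Rightarrow> bool" where
  "self_adjoint A \<longleftrightarrow> (\<forall>v w. ip (blinfun_apply A v) w = ip v (blinfun_apply A w))"

definition pos_ball :: "('h \<Rightarrow>\<^sub>L 'h) set" where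
  "pos_ball = {A \<in> bounded_ops. self_adjoint A \<and>
     (\<forall>v. norm v \<le> 1 \<longrightarrow> (\<exists>r\<in>{0..1}. ip (blinfun_apply A v) v = of_real r))}"

definition linear_map_on :: "'h set \<Rightarrow> ('h \<Rightarrow> 'h) \<Rightarrow> bool" where
  "linear_map_on E B \<longleftrightarrow>
     (\<forall>x\<in>E. \<forall>y\<in>E. B (x + y) = B x + B y) \<and> (\<forall>c. \<forall>x\<in>E. B (scale c x) = scale c (B x))"

text \<open>The operator norm of the restriction of \<open>f\<close> to \<open>E\<close>; used for finite-dimensional \<open>E\<close> and
  \<open>f\<close> linear on \<open>E\<close>, where the supremum is over a bounded set.\<close>

definition onorm_on :: "'h set \<Rightarrow> ('h \<Rightarrow> 'h) \<Rightarrow> real" where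
  "onorm_on E f = (SUP v\<in>{v\<in>E. norm v \<le> 1}. norm (f v))"

definition sot_basic :: "'h set \<Rightarrow> ('h \<Rightarrow> 'h) \<Rightarrow> real \<Rightarrow> ('h \<Rightarrow>\<^sub>L 'h) set" where
  "sot_basic E B \<epsilon> = {A \<in> bounded_ops. onorm_on E (\<lambda>v. blinfun_apply A v - B v) < \<epsilon>}"

definition sot :: "('h \<Rightarrow>\<^sub>L 'h) topology" where
  "sot = topology_generated_by
     {sot_basic E B \<epsilon> |E B \<epsilon>. subspace E \<and> finite_dim E \<and> linear_map_on E B \<and> \<epsilon> > 0}"

definition cyclic :: "('h \<Rightarrow>\<^sub>L 'h) \<Rightarrow> 'h \<Rightarrow> bool" where
  "cyclic A v \<longleftrightarrow> closure (span (range (\<lambda>n::nat. (blinfun_apply A ^^ n) v))) = UNIV"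

end

definition comeager_in :: "'a topology \<Rightarrow> 'a set \<Rightarrow> bool" where
  "comeager_in X C \<longleftrightarrow> C \<subseteq> topspace X \<and>
     (\<exists>\<G>. countable \<G> \<and> (\<forall>U\<in>\<G>. openin X U \<and> X closure_of U = topspace X) \<and>
          topspace X \<inter> \<Inter>\<G> \<subseteq> C)"

text \<open>Sanity checks: the standard real and complex structures are models, and \<open>sot\<close> is the
  library's \<^const>\<open>strong_operator_topology\<close> restricted to \<open>bounded_ops\<close> (lemma \<open>sot_eq\<close>).\<close>

lemma hilbert_space_real: "hilbert_space scaleR (inner :: 'h \<Rightarrow> 'h::{real_inner,banach} \<Rightarrow> real)"
proof unfold_locales
  show "inner y x = cnjg (inner x y)" for x y :: 'h by (simp add: cnjg_real_def inner_commute)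
qed (simp_all add: scaleR_right_distrib scaleR_left_distrib inner_add_left power2_norm_eq_inner)

lemma hilbert_space_complex:
  "hilbert_space ((*) :: complex \<Rightarrow> complex \<Rightarrow> complex) (\<lambda>x y. x * cnj y)"
  by unfold_locales
    (simp_all add: algebra_simps cnjg_complex_def complex_norm_square[symmetric] scaleR_conv_of_real
      del: of_real_power)

lemma cnjg_mult: "cnjg (x * y) = cnjg x * cnjg (y::'k::real_or_complex)"
proof (cases "x = 0 \<or> y = 0")
  case True
  have "cnjg (0::'k) = 0" using cnjg_add[of "0::'k" 0] by simp
  with True show ?thesis by auto
next
  case False
  have "(x * y) * cnjg (x * y) = (x * cnjg x) * (y * cnjg y)"
    unfolding mult_cnjg by (simp add: norm_mult power_mult_distrib)
  also have "\<dots> = (x * y) * (cnjg x * cnjg y)" by (simp add: algebra_simps)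
  finally show ?thesis using False by simp
qed

lemma cnjg_zero [simp]: "cnjg (0::'k::real_or_complex) = 0"
  using cnjg_add[of "0::'k" 0] by simp

context hilbert_space
begin

lemma ip_add_right: "ip x (y + z) = ip x y + ip x z"
  by (metis ip_cnjg ip_add_left cnjg_add)

lemma ip_scale_right: "ip x (scale c y) = cnjg c * ip x y"
  by (metis ip_cnjg ip_scale_left cnjg_mult)

lemma ip_zero_left [simp]: "ip 0 x = 0" using ip_add_left[of 0 0 x] by simp
lemma ip_diff_left: "ip (x - y) z = ip x z - ip y z"
  using ip_add_left[of "x - y" y z] by simp
lemma ip_sum_left: "ip (sum f I) z = (\<Sum>i\<in>I. ip (f i) z)"
  by (induction I rule: infinite_finite_induct) (auto simp: ip_add_left)

lemma norm_scale: "norm (scale c x) = norm c * norm x"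
proof -
  have "of_real ((norm (scale c x))\<^sup>2) = (c * cnjg c) * ip x x"
    unfolding ip_self[symmetric] by (simp add: ip_scale_left ip_scale_right)
  also have "\<dots> = of_real ((norm c * norm x)\<^sup>2)"
    by (simp only: mult_cnjg ip_self) (simp add: scaleR_conv_of_real power_mult_distrib)
  finally have "(norm (scale c x))\<^sup>2 = (norm c * norm x)\<^sup>2" by (simp only: of_real_eq_iff)
  then show ?thesis by simp
qed

lemma norm_ip_le:
  assumes "norm g = 1" shows "norm (ip v g) \<le> norm v"
proof -
  define w where "w = v - scale (ip v g) g"
  define u where "u = scale (ip v g) g"
  have wg: "ip w g = 0" unfolding w_def using assms by (simp add: ip_diff_left ip_scale_left ip_self)
  have wu: "ip w u = 0" unfolding u_def by (simp add: ip_scale_right wg)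
  have uw: "ip u w = 0" by (metis wu ip_cnjg cnjg_zero)
  have "v = w + u" by (simp add: w_def u_def)
  then have "ip v v = ip w w + ip u u" by (simp add: ip_add_left ip_add_right wu uw)
  then have "of_real ((norm v)\<^sup>2) = (of_real ((norm w)\<^sup>2 + (norm u)\<^sup>2) :: 'k)"
    unfolding ip_self by simp
  then have "(norm v)\<^sup>2 = (norm w)\<^sup>2 + (norm u)\<^sup>2" by (simp only: of_real_eq_iff)
  then have "(norm u)\<^sup>2 \<le> (norm v)\<^sup>2" by simp
  then have "norm u \<le> norm v" by (simp add: power2_le_iff_abs_le)
  then show ?thesis by (simp add: u_def norm_scale assms)
qed

definition orthonormal :: "'h set \<Rightarrow> bool" where
  "orthonormal G \<longleftrightarrow> (\<forall>g\<in>G. \<forall>h\<in>G. ip g h = (if g = h then 1 else 0))"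

lemma orthonormal_expand:
  assumes "finite G" "orthonormal G" "v \<in> span G"
  shows "v = (\<Sum>g\<in>G. scale (ip v g) g)"
proof -
  obtain u where u: "v = (\<Sum>g\<in>G. scale (u g) g)" using assms(3) unfolding span_finite[OF assms(1)] by auto
  have "ip v h = u h" if "h \<in> G" for h
  proof -
    have "ip v h = (\<Sum>g\<in>G. u g * ip g h)" unfolding u by (simp add: ip_sum_left ip_scale_left)
    also have "\<dots> = (\<Sum>g\<in>G. if g = h then u g else 0)"
      by (rule sum.cong) (use assms(2) that in \<open>auto simp: orthonormal_def\<close>)
    finally show ?thesis using that assms(1) by simp
  qed
  then show ?thesis using u by simp
qed

lemma orthonormal_exists:
  assumes "finite F" shows "\<exists>G. finite G \<and> orthonormal G \<and> span G = span F"
  using assms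
proof (induction F)
  case empty show ?case by (rule exI[of _ "{}"]) (simp add: orthonormal_def)
next
  case (insert a F)
  then obtain G where G: "finite G" "orthonormal G" "span G = span F" by auto
  define s where "s = (\<Sum>g\<in>G. scale (ip a g) g)"
  have sG: "s \<in> span G" unfolding s_def by (intro span_sum span_scale span_base)
  define b where "b = a - s"
  have bg: "ip b h = 0" if "h \<in> G" for h
  proof -
    have "ip s h = (\<Sum>g\<in>G. ip a g * ip g h)" by (simp add: s_def ip_sum_left ip_scale_left)
    also have "\<dots> = (\<Sum>g\<in>G. if g = h then ip a g else 0)"
      by (rule sum.cong) (use G(2) that in \<open>auto simp: orthonormal_def\<close>)
    finally show ?thesis using that G(1) by (simp add: b_def ip_diff_left)
  qed
  have sp: "span (insert a F) = span (insert b G)"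
  proof -
    have "span (insert a F) = span (insert a G)" using G(3) by (simp add: span_insert)
    also have "\<dots> = span (insert b G)" 
    proof (rule span_eq[THEN iffD2], intro conjI insert_subsetI)
      have i: "b \<in> span (insert b G)" "s \<in> span (insert b G)" "a \<in> span (insert a G)" "s \<in> span (insert a G)"
        using sG span_mono[of G "insert b G"] span_mono[of G "insert a G"] by (auto intro: span_base)
      show "a \<in> span (insert b G)" using span_add[OF i(1,2)] by (simp add: b_def)
      show "b \<in> span (insert a G)" using span_diff[OF i(3,4)] by (simp add: b_def)
    qed (auto intro: span_base)
    finally show ?thesis .
  qed
  show ?case
  proof (cases "b = 0")
    case True
    then show ?thesis using sp G by auto
  next
    case False
    define c where "c = scale (of_real (1 / norm b)) b"
    have nc: "ip c c = 1" using False by (simp add: ip_self c_def norm_scale norm_divide)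
    have cg: "ip c g = 0" "ip g c = 0" if "g \<in> G" for g
    proof -
      show *: "ip c g = 0" using bg[OF that] by (simp add: c_def ip_scale_left)
      show "ip g c = 0" by (metis * ip_cnjg cnjg_zero)
    qed
    have bc: "b = scale (of_real (norm b)) c" using False by (simp add: c_def)
    have "span (insert b G) = span (insert c G)"
    proof (rule span_eq[THEN iffD2], intro conjI insert_subsetI)
      show "b \<in> span (insert c G)" by (subst bc) (intro span_scale span_base, simp)
      show "c \<in> span (insert b G)" unfolding c_def by (intro span_scale span_base, simp)
    qed (auto intro: span_base)
    moreover have "orthonormal (insert c G)" using G(2) nc cg by (auto simp: orthonormal_def)
    ultimately show ?thesis using G(1) sp by (intro exI[of _ "insert c G"]) auto
  qed
qed

lemma linear_map_on_bounded:
  assumes "finite G" "orthonormal G" "linear_map_on (span G) f" "v \<in> span G"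
  shows "norm (f v) \<le> (\<Sum>g\<in>G. norm (f g)) * norm v"
proof -
  have f0: "f 0 = 0" using assms(3) span_zero unfolding linear_map_on_def
    by (metis add_cancel_right_left)
  have "f (\<Sum>g\<in>I. scale (u g) g) = (\<Sum>g\<in>I. scale (u g) (f g)) \<and> (\<Sum>g\<in>I. scale (u g) g) \<in> span G"
    if "finite I" "I \<subseteq> G" for I u
    using that
  proof (induction I)
    case (insert x I)
    have "scale (u x) x \<in> span G" "x \<in> span G" using insert by (auto intro: span_base span_scale)
    then show ?case using insert assms(3) by (simp add: linear_map_on_def span_add)
  qed (simp add: f0 span_zero)
  from this[of G "ip v"] have "f v = (\<Sum>g\<in>G. scale (ip v g) (f g))"
    using assms(1) orthonormal_expand[OF assms(1,2,4)] by simp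
  also have "norm \<dots> \<le> (\<Sum>g\<in>G. norm (ip v g) * norm (f g))"
    by (rule order_trans[OF norm_sum]) (simp add: norm_scale)
  also have "\<dots> \<le> (\<Sum>g\<in>G. norm v * norm (f g))"
  proof (intro sum_mono mult_right_mono norm_ip_le)
    fix g assume "g \<in> G"
    then have "of_real ((norm g)\<^sup>2) = (of_real 1 :: 'k)"
      using assms(2) unfolding orthonormal_def ip_self[symmetric] by simp
    then have "(norm g)\<^sup>2 = 1" by (simp only: of_real_eq_iff)
    then show "norm g = 1" by (simp add: power2_eq_1_iff) (smt (verit) norm_ge_zero)
  qed auto
  finally show ?thesis by (simp add: sum_distrib_left mult.commute)
qed

lemma onorm_on_le:
  assumes "subspace E" "\<And>v. v \<in> E \<Longrightarrow> norm v \<le> 1 \<Longrightarrow> norm (f v) \<le> c"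
  shows "onorm_on E f \<le> c"
  unfolding onorm_on_def using assms subspace_0[OF assms(1)] by (intro cSUP_least) auto

lemma norm_le_onorm_on:
  assumes "finite_dim E" "linear_map_on E f" "v \<in> E" "norm v \<le> 1"
  shows "norm (f v) \<le> onorm_on E f"
proof -
  obtain G where G: "finite G" "orthonormal G" "span G = E"
    using assms(1) orthonormal_exists unfolding finite_dim_def by metis
  have "norm (f v) \<le> (\<Sum>g\<in>G. norm (f g))" if "v \<in> E" "norm v \<le> 1" for v
  proof -
    have "norm (f v) \<le> (\<Sum>g\<in>G. norm (f g)) * norm v"
      using linear_map_on_bounded[OF G(1,2)] assms(2) that G(3) by simp
    also have "\<dots> \<le> (\<Sum>g\<in>G. norm (f g)) * 1"
      using that by (intro mult_left_mono sum_nonneg) auto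
    finally show ?thesis by simp
  qed
  then have "bdd_above ((\<lambda>v. norm (f v)) ` {v\<in>E. norm v \<le> 1})"
    by (intro bdd_aboveI2) auto
  then show ?thesis unfolding onorm_on_def using assms(3,4) by (intro cSUP_upper) auto
qed

lemma linear_map_on_op: "A \<in> bounded_ops \<Longrightarrow> linear_map_on E (blinfun_apply A)"
  by (simp add: bounded_ops_def linear_map_on_def blinfun.add_right)

lemma linear_map_on_diff:
  "linear_map_on E f \<Longrightarrow> linear_map_on E g \<Longrightarrow> linear_map_on E (\<lambda>v. f v - g v)"
  by (simp add: linear_map_on_def scale_right_diff_distrib)

lemma sot_basic_zero: "sot_basic (span {}) (\<lambda>_. 0) 1 = bounded_ops"
  by (auto simp: sot_basic_def onorm_on_def)

lemma openin_sot_basic: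
  "subspace E \<Longrightarrow> finite_dim E \<Longrightarrow> linear_map_on E B \<Longrightarrow> \<epsilon> > 0 \<Longrightarrow> openin sot (sot_basic E B \<epsilon>)"
  unfolding sot_def by (rule topology_generated_by_Basis) blast

lemma topspace_sot: "topspace sot = bounded_ops"
proof
  show "topspace sot \<subseteq> bounded_ops"
    by (auto simp: sot_def topology_generated_by_topspace sot_basic_def)
  have "openin sot (sot_basic (span {}) (\<lambda>_. 0) 1)"
    by (intro openin_sot_basic) (auto simp: finite_dim_def linear_map_on_def intro: exI[of _ "{}"])
  then show "bounded_ops \<subseteq> topspace sot" unfolding sot_basic_zero by (rule openin_subset)
qed

lemma openin_strong_sot_basic:
  assumes "subspace E" "finite_dim E" "linear_map_on E B" "\<epsilon> > 0"
  shows "openin (subtopology strong_operator_topology bounded_ops) (sot_basic E B \<epsilon>)"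
proof (subst openin_subopen, intro ballI)
  fix A assume A: "A \<in> sot_basic E B \<epsilon>"
  obtain G where G: "finite G" "orthonormal G" "span G = E"
    using assms(2) orthonormal_exists unfolding finite_dim_def by metis
  define s where "s = onorm_on E (\<lambda>v. blinfun_apply A v - B v)"
  define d where "d = (\<epsilon> - s) / (2 * (real (card G) + 1))"
  have sl: "s < \<epsilon>" and Ab: "A \<in> bounded_ops" using A by (auto simp: sot_basic_def s_def)
  have d: "d > 0" using sl by (simp add: d_def)
  define T where "T = bounded_ops \<inter> {C. \<forall>g\<in>G. blinfun_apply C g \<in> ball (blinfun_apply A g) d}"
  have "openin (subtopology strong_operator_topology bounded_ops) T"
    unfolding T_def openin_subtopology_alt
    using strong_operator_topology_basis[OF G(1), of "\<lambda>g. ball (blinfun_apply A g) d" "\<lambda>g. g"] by blast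
  moreover have "A \<in> T" using Ab d by (simp add: T_def)
  moreover have "T \<subseteq> sot_basic E B \<epsilon>"
  proof
    fix C assume C: "C \<in> T"
    then have Cb: "C \<in> bounded_ops" by (simp add: T_def)
    have "onorm_on E (\<lambda>v. blinfun_apply C v - B v) \<le> s + (\<epsilon> - s) / 2"
    proof (rule onorm_on_le[OF assms(1)])
      fix v assume v: "v \<in> E" "norm v \<le> 1"
      have 1: "norm (blinfun_apply A v - B v) \<le> s"
        unfolding s_def using norm_le_onorm_on[OF assms(2) linear_map_on_diff[OF linear_map_on_op[OF Ab] assms(3)] v] .
      have "norm (blinfun_apply C v - blinfun_apply A v)
         \<le> (\<Sum>g\<in>G. norm (blinfun_apply C g - blinfun_apply A g)) * norm v"
        using linear_map_on_bounded[OF G(1,2) linear_map_on_diff[OF linear_map_on_op[OF Cb] linear_map_on_op[OF Ab]]]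
          v G(3) by simp
      also have "\<dots> \<le> (\<Sum>g\<in>G. d) * 1"
        using C v by (intro mult_mono sum_mono sum_nonneg) (auto simp: T_def dist_norm norm_minus_commute less_imp_le d)
      also have "\<dots> = real (card G) * d" by simp
      also have "\<dots> \<le> (real (card G) + 1) * d" using d by (simp add: algebra_simps)
      also have "\<dots> = (\<epsilon> - s) / 2"
      proof -
        have "n * ((\<epsilon> - s) / (2 * n)) = (\<epsilon> - s) / 2" if "n \<noteq> 0" for n :: real
          using that by simp
        moreover have "real (card G) + 1 \<noteq> 0" by linarith
        ultimately show ?thesis unfolding d_def by blast
      qed
      finally have 2: "norm (blinfun_apply C v - blinfun_apply A v) \<le> (\<epsilon> - s) / 2" .
      have "blinfun_apply C v - B v = (blinfun_apply A v - B v) + (blinfun_apply C v - blinfun_apply A v)" by simp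
      then show "norm (blinfun_apply C v - B v) \<le> s + (\<epsilon> - s) / 2"
        using norm_triangle_mono[OF 1 2] by simp
    qed
    also have "\<dots> < \<epsilon>" using sl by (simp add: field_simps)
    finally show "C \<in> sot_basic E B \<epsilon>" using Cb by (simp add: sot_basic_def)
  qed
  ultimately show "\<exists>T. openin (subtopology strong_operator_topology bounded_ops) T \<and> A \<in> T \<and> T \<subseteq> sot_basic E B \<epsilon>"
    by blast
qed

lemma continuous_map_sot_eval: "continuous_map sot euclidean (\<lambda>A. blinfun_apply A x)"
  unfolding continuous_map_def
proof (intro conjI allI impI)
  fix W :: "'h set" assume "openin euclidean W"
  then have W: "open W" by simp
  show "openin sot {A \<in> topspace sot. blinfun_apply A x \<in> W}"
  proof (subst openin_subopen, intro ballI)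
    fix A assume "A \<in> {A \<in> topspace sot. blinfun_apply A x \<in> W}"
    then have A: "A \<in> bounded_ops" "blinfun_apply A x \<in> W" by (auto simp: topspace_sot)
    obtain r where r: "r > 0" "ball (blinfun_apply A x) r \<subseteq> W" using W A(2) openE by metis
    define e where "e = r / (norm x + 1)"
    have e: "e > 0" using r(1) by (simp add: e_def add_nonneg_pos)
    let ?E = "span {x}"
    have fd: "finite_dim ?E" unfolding finite_dim_def by (rule exI[of _ "{x}"]) simp
    have o: "openin sot (sot_basic ?E (blinfun_apply A) e)"
      using openin_sot_basic fd linear_map_on_op[OF A(1)] e by simp
    have m: "A \<in> sot_basic ?E (blinfun_apply A) e"
      using e A(1) onorm_on_le[of ?E "\<lambda>v. blinfun_apply A v - blinfun_apply A v" 0] by (simp add: sot_basic_def)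
    have "sot_basic ?E (blinfun_apply A) e \<subseteq> {A \<in> topspace sot. blinfun_apply A x \<in> W}"
    proof
      fix C assume C: "C \<in> sot_basic ?E (blinfun_apply A) e"
      then have Cb: "C \<in> bounded_ops" and Ce: "onorm_on ?E (\<lambda>v. blinfun_apply C v - blinfun_apply A v) < e"
        by (auto simp: sot_basic_def)
      define t where "t = 1 / (norm x + 1)"
      have t: "t > 0" by (simp add: t_def add_nonneg_pos)
      have "t *\<^sub>R x \<in> ?E" unfolding scale_of_real[symmetric] by (intro span_scale span_base) simp
      moreover have "norm (t *\<^sub>R x) \<le> 1" by (simp add: t_def divide_le_eq_1 add_nonneg_pos)
      ultimately have "norm (blinfun_apply C (t *\<^sub>R x) - blinfun_apply A (t *\<^sub>R x)) < e"
        using norm_le_onorm_on[OF fd linear_map_on_diff[OF linear_map_on_op[OF Cb] linear_map_on_op[OF A(1)]]] Ce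
        by (meson order_le_less_trans)
      also have "e = t * r" by (simp add: e_def t_def)
      finally have "norm (blinfun_apply C x - blinfun_apply A x) < r"
        using t by (simp add: blinfun.scaleR_right flip: scaleR_diff_right)
      then have "blinfun_apply C x \<in> W" using r(2) by (auto simp: dist_norm norm_minus_commute)
      then show "C \<in> {A \<in> topspace sot. blinfun_apply A x \<in> W}" using Cb by (simp add: topspace_sot)
    qed
    then show "\<exists>T. openin sot T \<and> A \<in> T \<and> T \<subseteq> {A \<in> topspace sot. blinfun_apply A x \<in> W}"
      using o m by blast
  qed
qed auto

lemma sot_eq: "sot = subtopology strong_operator_topology bounded_ops"
  unfolding topology_eq
proof (intro allI iffI)
  fix U assume "openin sot U"
  then have "generate_topology_on {sot_basic E B \<epsilon> |E B \<epsilon>. subspace E \<and> finite_dim E \<and> linear_map_on E B \<and> \<epsilon> > 0} U"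
    unfolding sot_def openin_topology_generated_by_iff .
  then show "openin (subtopology strong_operator_topology bounded_ops) U"
  proof induction
    case (Basis s)
    then show ?case using openin_strong_sot_basic by blast
  qed (auto intro: openin_Int openin_Union)
next
  fix U assume "openin (subtopology strong_operator_topology bounded_ops) U"
  then obtain V where V: "openin strong_operator_topology V" "U = V \<inter> bounded_ops"
    by (auto simp: openin_subtopology)
  have "continuous_map sot strong_operator_topology (\<lambda>A. A)"
    unfolding continuous_on_strong_operator_topo_iff_coordinatewise using continuous_map_sot_eval by blast
  from openin_continuous_map_preimage[OF this V(1)]
  show "openin sot U" by (simp add: V(2) topspace_sot Int_def conj_commute)
qed


end
end

theory Submission
  imports Defs
begin

text \<open>
  Cyclicity of all nonzero vectors of \<open>span S\<close> is the intersection of the conditions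
  \<open>approx_cyclic F w \<delta>\<close>: for every unit vector \<open>v\<close> of \<open>span F\<close>, some element of the span of the
  orbit of \<open>v\<close> lies within \<open>\<delta>\<close> of \<open>w\<close>. Here \<open>F\<close> runs through the finite subsets of \<open>S\<close>, \<open>w\<close> through
  a countable dense set and \<open>\<delta>\<close> through the numbers \<open>1 / (n + 1)\<close>, so there are only countably many
  conditions. Each is open (\<open>openin_approx_cyclic\<close>), because \<open>(A, v) \<mapsto> A\<^sup>n v\<close> is jointly continuous
  on contractions and the unit sphere of \<open>span F\<close> is compact.

  The substance is density (\<open>approx_cyclic_meets_nbhd\<close>), and it needs only finite-rank operators.
  Given \<open>A\<close> and finitely many test vectors, compress \<open>A\<close> to the finite-dimensional space \<open>V\<close> spanned by the
  test vectors, their images, \<open>F\<close> and \<open>w\<close>; the compression agrees with \<open>A\<close> on the test vectors.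
  Diagonalise it in an orthonormal basis \<open>e\<^sub>0, \<dots>, e\<^sub>m\<^sub>-\<^sub>1\<close> of \<open>V\<close> and move the eigenvalues slightly, to
  distinct \<open>\<mu>\<^sub>i\<close> in the interior of \<open>[0, 1]\<close>. Continue the basis by orthonormal vectors
  \<open>e\<^sub>m, \<dots>, e\<^sub>N\<^sub>-\<^sub>1\<close> on which the operator is the Jacobi matrix with diagonal \<open>1/2\<close> and off-diagonal
  \<open>1/4\<close>, and couple every \<open>e\<^sub>i\<close>, \<open>i < m\<close>, to \<open>e\<^sub>m\<close> by a small constant \<open>a\<close>. Diagonal dominance keeps
  this operator a positive contraction (\<open>mat_op_pos_ball\<close>), and it remains close to \<open>A\<close> on the
  test vectors. Two facts about it give the result.

  Its eigenvectors are spread out (\<open>eigenvector_components_small\<close>): along the tail an eigenvector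
  solves \<open>z\<^sub>k\<^sub>+\<^sub>2 = c z\<^sub>k\<^sub>+\<^sub>1 - z\<^sub>k\<close> with \<open>\<bar>c\<bar> \<le> 2\<close>, so it cannot decay along the tail, and
  a unit eigenvector has small coordinates at the start of a long tail; since the \<open>\<mu>\<^sub>i\<close> are
  distinct and all \<open>e\<^sub>i\<close> are coupled to the tail, its coordinates in \<open>V\<close> are small as well.

  A nonzero \<open>v\<close> in \<open>V\<close> misses few eigenvectors: the span \<open>K\<close> of its orbit, together with \<open>V\<close>,
  spans all \<open>e\<^sub>k\<close>, \<open>k < N\<close> (\<open>krylov_with_head_spans\<close>), so, within their span, the orthogonal complement of \<open>K\<close>, which is invariant,
  is spanned by at most \<open>m\<close> orthonormal eigenvectors, a bound that does not depend on the length of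
  the tail. Consequently \<open>w\<close> is almost orthogonal to this complement, that is, close to \<open>K\<close>.
\<close>

section \<open>Geometry of the inner product\<close>

lemma cnjg_of_real [simp]: "cnjg (of_real r :: 'k::real_or_complex) = of_real r"
proof (cases "r = 0")
  case False
  have "of_real r * cnjg (of_real r :: 'k) = of_real r * of_real r"
    by (simp add: mult_cnjg scaleR_conv_of_real power2_eq_square)
  then show ?thesis using False by simp
qed simp

lemma norm_cnjg [simp]: "norm (cnjg (x :: 'k::real_or_complex)) = norm x"
proof (cases "x = 0")
  case False
  have "norm x * norm (cnjg x) = norm (x * cnjg x)" by (simp add: norm_mult)
  also have "\<dots> = norm x * norm x" by (simp add: mult_cnjg power2_eq_square)
  finally show ?thesis using False by simp
qed simp

context hilbert_space
begin

lemma ip_zero_right [simp]: "ip x 0 = 0"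
  by (metis ip_cnjg ip_zero_left cnjg_zero)

lemma ip_diff_right: "ip x (y - z) = ip x y - ip x z"
  using ip_add_right[of x "y - z" z] by simp

lemma ip_sum_right: "ip x (sum f I) = (\<Sum>i\<in>I. ip x (f i))"
  by (induction I rule: infinite_finite_induct) (auto simp: ip_add_right)

lemma ip_eq_0_commute: "ip x y = 0 \<longleftrightarrow> ip y x = 0"
  by (metis ip_cnjg cnjg_zero)

lemma ip_self_eq_0 [simp]: "ip x x = 0 \<longleftrightarrow> x = 0"
  by (simp add: ip_self)

lemma ip_scaleR_left: "ip (r *\<^sub>R x) y = of_real r * ip x y"
  by (simp add: ip_scale_left flip: scale_of_real)

lemma ip_scaleR_right: "ip x (r *\<^sub>R y) = of_real r * ip x y"
  by (simp add: ip_scale_right flip: scale_of_real)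

lemma cauchy_schwarz: "norm (ip x y) \<le> norm x * norm y"
proof (cases "y = 0")
  case False
  have "norm (ip x ((1 / norm y) *\<^sub>R y)) \<le> norm x"
    using False by (intro norm_ip_le) simp
  then show ?thesis using False by (simp add: ip_scaleR_right norm_mult norm_divide divide_simps)
qed simp

lemma bounded_linear_ip_left: "bounded_linear (\<lambda>x. ip x y)"
  by (rule bounded_linear_intro[where K = "norm y"])
    (simp_all add: ip_add_left ip_scaleR_left cauchy_schwarz scaleR_conv_of_real)

lemma bounded_linear_scale: "bounded_linear (\<lambda>c. scale c x)"
  by (rule bounded_linear_intro[where K = "norm x"])
    (simp_all add: scale_left_distrib norm_scale scaleR_conv_of_real flip: scale_of_real)

lemma ip_zero_span:
  assumes "\<And>g. g \<in> G \<Longrightarrow> ip x g = 0" "y \<in> span G"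
  shows "ip x y = 0"
  using assms(2) by (induction rule: span_induct_alt) (auto simp: ip_add_right ip_scale_right assms(1))

lemma subspace_scaleR: "subspace W \<Longrightarrow> x \<in> W \<Longrightarrow> r *\<^sub>R x \<in> W"
  by (simp add: subspace_scale flip: scale_of_real)

lemma orthonormalD: "orthonormal G \<Longrightarrow> g \<in> G \<Longrightarrow> h \<in> G \<Longrightarrow> ip g h = (if g = h then 1 else 0)"
  by (simp add: orthonormal_def)

lemma orthonormal_norm: "orthonormal G \<Longrightarrow> g \<in> G \<Longrightarrow> norm g = 1"
proof -
  assume "orthonormal G" "g \<in> G"
  then have "of_real ((norm g)\<^sup>2) = (of_real 1 :: 'k)"
    unfolding orthonormal_def ip_self[symmetric] by simp
  then have "(norm g)\<^sup>2 = 1" by (simp only: of_real_eq_iff)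
  then show ?thesis by (simp add: power2_eq_1_iff) (smt (verit) norm_ge_zero)
qed

lemma orthonormal_independent:
  assumes "orthonormal G" shows "independent G"
proof
  assume "dependent G"
  then obtain g where g: "g \<in> G" "g \<in> span (G - {g})" unfolding dependent_def by blast
  have "ip g g = 0" using g assms by (intro ip_zero_span[OF _ g(2)]) (auto simp: orthonormal_def)
  then show False using orthonormal_norm[OF assms g(1)] by auto
qed

text \<open>This is how subspaces known only to sit inside a finite-dimensional space (orbit spans,
  orthogonal complements) acquire orthonormal bases.\<close>

lemma subspace_orthonormal_basis:
  assumes "finite F" "subspace W" "W \<subseteq> span F"
  obtains G where "finite G" "orthonormal G" "span G = W" 
proof -
  obtain B where B: "B \<subseteq> W" "independent B" "W \<subseteq> span B"
    using maximal_independent_subset[of W] by blast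
  have "finite B" using independent_span_bound[OF assms(1) B(2)] B(1) assms(3) by blast
  moreover have "span B = W" using B(1,3) assms(2) by (simp add: span_minimal subset_antisym)
  ultimately show ?thesis using that orthonormal_exists[of B] by auto
qed

definition proj :: "'h set \<Rightarrow> 'h \<Rightarrow> 'h" where
  "proj G x = (\<Sum>g\<in>G. scale (ip x g) g)"

lemma proj_in_span: "proj G x \<in> span G"
  unfolding proj_def by (intro span_sum span_scale span_base)

lemma proj_id: "finite G \<Longrightarrow> orthonormal G \<Longrightarrow> x \<in> span G \<Longrightarrow> proj G x = x"
  unfolding proj_def by (rule orthonormal_expand[symmetric])

lemma proj_add: "proj G (x + y) = proj G x + proj G y"
  by (simp add: proj_def ip_add_left scale_left_distrib sum.distrib)

lemma proj_scale: "proj G (scale c x) = scale c (proj G x)"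
  by (simp add: proj_def ip_scale_left scale_sum_right)

lemma ip_proj_basis:
  assumes "finite G" "orthonormal G" "g \<in> G"
  shows "ip (proj G x) g = ip x g"
proof -
  have "ip (proj G x) g = (\<Sum>h\<in>G. ip x h * ip h g)" by (simp add: proj_def ip_sum_left ip_scale_left)
  also have "\<dots> = (\<Sum>h\<in>G. if h = g then ip x g else 0)"
    by (rule sum.cong) (use assms in \<open>auto simp: orthonormal_def\<close>)
  finally show ?thesis using assms by simp
qed

lemma ip_proj:
  assumes "finite G" "orthonormal G" "y \<in> span G"
  shows "ip (proj G x) y = ip x y"
proof -
  have "ip (proj G x - x) y = 0"
    by (rule ip_zero_span[OF _ assms(3)]) (simp add: ip_diff_left ip_proj_basis assms)
  then show ?thesis by (simp add: ip_diff_left)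
qed

text \<open>The sum is both \<open>\<langle>x, proj x\<rangle>\<close> and \<open>\<parallel>proj x\<parallel>\<^sup>2\<close>, so Cauchy--Schwarz shows that the projection
  is a contraction.\<close>

lemma bessel:
  assumes "finite G" "orthonormal G"
  shows "(\<Sum>g\<in>G. (norm (ip x g))\<^sup>2) \<le> (norm x)\<^sup>2"
proof -
  let ?s = "\<Sum>g\<in>G. (norm (ip x g))\<^sup>2"
  have "ip x (proj G x) = (\<Sum>g\<in>G. ip x g * cnjg (ip x g))"
    by (simp add: proj_def ip_sum_right ip_scale_right mult.commute)
  also have "\<dots> = of_real ?s" by (simp only: mult_cnjg of_real_sum) (simp add: scaleR_conv_of_real)
  finally have 1: "ip x (proj G x) = of_real ?s" .
  have 0: "?s \<ge> 0" by (intro sum_nonneg) simp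
  have "of_real ((norm (proj G x))\<^sup>2) = (of_real ?s :: 'k)"
    using ip_proj[OF assms proj_in_span, of x x] unfolding 1 by (simp add: ip_self)
  then have 2: "(norm (proj G x))\<^sup>2 = ?s" by (simp only: of_real_eq_iff)
  have "?s = norm (ip x (proj G x))" unfolding 1 norm_of_real using 0 by simp
  also have "\<dots> \<le> norm x * norm (proj G x)" by (rule cauchy_schwarz)
  finally have "norm (proj G x) * norm (proj G x) \<le> norm x * norm (proj G x)"
    using 2 by (simp add: power2_eq_square)
  then have "norm (proj G x) \<le> norm x" by (cases "norm (proj G x) = 0") auto
  then show ?thesis unfolding 2[symmetric] by (simp add: power_mono)
qed

section \<open>The finite-dimensional spectral theorem\<close>

text \<open>Bounded coefficient vectors with respect to an orthonormal basis form a product of discs, and the sphere is a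
  closed part of its continuous image. The image is built one basis vector at a time.\<close>

lemma compact_unit_sphere:
  assumes "finite F"
  shows "compact {x \<in> span F. norm x = 1}"
proof -
  obtain G where G: "finite G" "orthonormal G" "span G = span F" using orthonormal_exists[OF assms] by blast
  define C where "C = (\<lambda>G. {\<Sum>g\<in>G. scale (c g) g |c. \<forall>g\<in>G. norm (c g :: 'k) \<le> 1})"
  have "compact (C G)" using G(1)
  proof (induction G)
    case empty
    have "C {} = {0}" by (auto simp: C_def)
    then show ?case by simp
  next
    case (insert a G)
    have "C (insert a G) = (\<lambda>p. scale (fst p) a + snd p) ` (cball 0 1 \<times> C G)" (is "_ = ?R")
    proof
      show "C (insert a G) \<subseteq> ?R"
        using insert(1,2) by (force simp: C_def)
      show "?R \<subseteq> C (insert a G)"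
      proof
        fix x assume "x \<in> ?R"
        then obtain d c where dc: "norm d \<le> 1" "\<forall>g\<in>G. norm (c g :: 'k) \<le> 1"
          "x = scale d a + (\<Sum>g\<in>G. scale (c g) g)" by (auto simp: C_def)
        have "(\<Sum>g\<in>G. scale (c g) g) = (\<Sum>g\<in>G. scale ((c(a := d)) g) g)"
          using insert(2) by (intro sum.cong) auto
        then have "x = (\<Sum>g\<in>insert a G. scale ((c(a := d)) g) g)" using insert(1,2) dc(3) by simp
        moreover have "\<forall>g\<in>insert a G. norm ((c(a := d)) g) \<le> 1" using dc by auto
        ultimately show "x \<in> C (insert a G)" unfolding C_def by blast
      qed
    qed
    moreover have "continuous_on A (\<lambda>p. scale (fst p) a + snd p)" for A
      by (intro continuous_intros bounded_linear.continuous_on[OF bounded_linear_scale])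
    ultimately show ?case using insert.IH by (metis compact_Times compact_cball compact_continuous_image)
  qed
  moreover have "{x \<in> span F. norm x = 1} = C G \<inter> sphere 0 1"
  proof
    show "{x \<in> span F. norm x = 1} \<subseteq> C G \<inter> sphere 0 1"
    proof clarify
      fix x assume x: "x \<in> span F" "norm x = 1"
      have "x = (\<Sum>g\<in>G. scale (ip x g) g)" using x(1) G by (intro orthonormal_expand) auto
      moreover have "\<forall>g\<in>G. norm (ip x g) \<le> 1"
        using norm_ip_le x(2) orthonormal_norm[OF G(2)] by metis
      ultimately show "x \<in> C G \<inter> sphere 0 1" using x(2) unfolding C_def by auto
    qed
    show "C G \<inter> sphere 0 1 \<subseteq> {x \<in> span F. norm x = 1}"
      unfolding C_def G(3)[symmetric] by (auto intro!: span_sum span_scale intro: span_base)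
  qed
  moreover have "closed (sphere 0 1 :: 'h set)"
    unfolding sphere_def by (intro closed_Collect_eq continuous_intros)
  ultimately show ?thesis by (simp add: compact_Int_closed)
qed

text \<open>Let \<open>x\<close> maximise \<open>\<parallel>T x\<parallel>\<close> on the unit sphere, with maximum \<open>s\<close>. Then
  \<open>\<parallel>T\<^sup>2 x - s\<^sup>2 x\<parallel>\<^sup>2 = \<parallel>T\<^sup>2 x\<parallel>\<^sup>2 - s\<^sup>4 \<le> 0\<close>, so \<open>(T - s) (T + s) x = 0\<close>: either \<open>x\<close> itself or
  \<open>(T + s) x\<close> is an eigenvector. The argument is the same over both scalar fields, and the
  eigenvalue is real by construction.\<close>

lemma symmetric_eigenvector_exists:
  assumes F: "finite F" "W = span F" "W \<noteq> {0}"
    and lin: "linear_map_on W T" and inv: "\<And>x. x \<in> W \<Longrightarrow> T x \<in> W"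
    and sym: "\<And>x y. x \<in> W \<Longrightarrow> y \<in> W \<Longrightarrow> ip (T x) y = ip x (T y)"
  obtains y r where "y \<in> W" "norm y = 1" "T y = r *\<^sub>R y"
proof -
  have sub: "subspace W" using F(2) by simp
  obtain G where G: "finite G" "orthonormal G" "span G = W"
    using orthonormal_exists[OF F(1)] F(2) by blast
  define c where "c = (\<Sum>g\<in>G. norm (T g))"
  have T_bound: "norm (T x) \<le> c * norm x" if "x \<in> W" for x
    unfolding c_def using linear_map_on_bounded[OF G(1,2)] G(3) lin that by blast
  have T_add: "T (x + y) = T x + T y" if "x \<in> W" "y \<in> W" for x y
    using lin that by (simp add: linear_map_on_def)
  have T_scale: "T (r *\<^sub>R x) = r *\<^sub>R T x" if "x \<in> W" for x r
    using lin that by (simp add: linear_map_on_def flip: scale_of_real)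
  have T_diff: "T (x - y) = T x - T y" if "x \<in> W" "y \<in> W" for x y
    using T_add[of "x - y" y] that sub by (simp add: subspace_diff)
  let ?K = "{x \<in> W. norm x = 1}"
  have "continuous_on ?K (\<lambda>x. norm (T x))"
  proof (rule continuous_on_norm, rule continuous_onI)
    fix x and e :: real assume x: "x \<in> ?K" and e: "e > 0"
    have c: "c \<ge> 0" unfolding c_def by (intro sum_nonneg) simp
    show "\<exists>d>0. \<forall>x'\<in>?K. dist x' x < d \<longrightarrow> dist (T x') (T x) \<le> e"
    proof (intro exI conjI ballI impI)
      show "e / (c + 1) > 0" using e c by simp
      fix x' assume x': "x' \<in> ?K" "dist x' x < e / (c + 1)"
      have "dist (T x') (T x) \<le> c * dist x' x"
        using T_bound[of "x' - x"] x x' sub by (simp add: dist_norm T_diff subspace_diff)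
      also have "\<dots> \<le> (c + 1) * (e / (c + 1))"
        using x'(2) c by (intro mult_mono) auto
      finally show "dist (T x') (T x) \<le> e" using c by simp
    qed
  qed
  moreover have "compact ?K" using compact_unit_sphere[OF F(1)] F(2) by simp
  moreover have "?K \<noteq> {}"
  proof -
    obtain x where "x \<in> W" "x \<noteq> 0" using F(3) sub subspace_0 by blast
    then have "(1 / norm x) *\<^sub>R x \<in> ?K" using subspace_scaleR[OF sub] by simp
    then show ?thesis by blast
  qed
  ultimately obtain x where x: "x \<in> W" "norm x = 1" 
    and max: "\<And>z. z \<in> W \<Longrightarrow> norm z = 1 \<Longrightarrow> norm (T z) \<le> norm (T x)"
    using continuous_attains_sup[of ?K "\<lambda>x. norm (T x)"] by auto
  define s where "s = norm (T x)"
  have le: "norm (T z) \<le> s * norm z" if z: "z \<in> W" for z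
  proof (cases "z = 0")
    case True
    then show ?thesis using T_bound[OF z] by simp
  next
    case False
    have "norm (T ((1 / norm z) *\<^sub>R z)) \<le> s"
      unfolding s_def using False z by (intro max subspace_scaleR sub) auto
    then show ?thesis using False by (simp add: T_scale z divide_simps)
  qed
  define a where "a = T (T x)"
  have TW: "T x \<in> W" using inv x by blast
  have na: "norm a \<le> s * s" unfolding a_def using le[OF TW] by (simp add: s_def)
  have ax: "ip a x = of_real (s * s)"
    unfolding a_def by (subst sym) (use TW x in \<open>auto simp: ip_self s_def power2_eq_square\<close>)
  have xa: "ip x a = of_real (s * s)" by (metis ax ip_cnjg cnjg_of_real)
  have "of_real ((norm (a - (s * s) *\<^sub>R x))\<^sup>2) = (of_real ((norm a)\<^sup>2 - (s * s) * (s * s)) :: 'k)"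
    unfolding ip_self[symmetric]
    by (simp add: ip_diff_left ip_diff_right ip_scaleR_left ip_scaleR_right ax xa x(2) ip_self[of a] ip_self[of x])
  then have "(norm (a - (s * s) *\<^sub>R x))\<^sup>2 = (norm a)\<^sup>2 - (s * s) * (s * s)"
    by (simp only: of_real_eq_iff)
  also have "\<dots> \<le> 0" using mult_mono[OF na na] by (simp add: power2_eq_square)
  finally have TTx: "T (T x) = (s * s) *\<^sub>R x" by (simp add: a_def)
  define z where "z = T x + s *\<^sub>R x"
  have zW: "z \<in> W" unfolding z_def by (intro subspace_add subspace_scaleR sub TW x)
  have Tz: "T z = s *\<^sub>R z"
    unfolding z_def using TW x sub
    by (simp add: T_add T_scale TTx subspace_scaleR scaleR_add_right)
  show ?thesis
  proof (cases "z = 0")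
    case True
    then have "T x = (- s) *\<^sub>R x" unfolding z_def by (simp add: eq_neg_iff_add_eq_0)
    then show ?thesis using that x by blast
  next
    case False
    have "T ((1 / norm z) *\<^sub>R z) = s *\<^sub>R ((1 / norm z) *\<^sub>R z)" using zW by (simp add: T_scale Tz)
    then show ?thesis using that[of "(1 / norm z) *\<^sub>R z"] False zW subspace_scaleR[OF sub] by simp
  qed
qed

text \<open>The orthogonal complement of a largest orthonormal set of eigenvectors is invariant, so it
  would contain a further eigenvector unless it is zero.\<close>

theorem symmetric_eigenbasis:
  assumes F: "finite F" "W = span F"
    and lin: "linear_map_on W T" and inv: "\<And>x. x \<in> W \<Longrightarrow> T x \<in> W"
    and sym: "\<And>x y. x \<in> W \<Longrightarrow> y \<in> W \<Longrightarrow> ip (T x) y = ip x (T y)"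
  obtains Y where "finite Y" "orthonormal Y" "span Y = W" "\<And>y. y \<in> Y \<Longrightarrow> \<exists>r. T y = r *\<^sub>R y"
proof -
  have sub: "subspace W" using F(2) by simp
  define P where "P = (\<lambda>Y. orthonormal Y \<and> Y \<subseteq> W \<and> (\<forall>y\<in>Y. \<exists>r. T y = r *\<^sub>R y))"
  have bd: "finite Y \<and> card Y \<le> card F" if "P Y" for Y
    using that independent_span_bound[OF F(1), of Y] orthonormal_independent F(2) by (auto simp: P_def)
  have "P {}" by (simp add: P_def orthonormal_def)
  then obtain Y where Y: "P Y" and max: "\<And>Z. P Z \<Longrightarrow> card Z \<le> card Y"
    using ex_has_greatest_nat[of P "{}" card "Suc (card F)"] bd by (metis less_Suc_eq_le)
  have fin: "finite Y" and on: "orthonormal Y" and YW: "Y \<subseteq> W" using Y bd by (auto simp: P_def)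
  have spW: "span Y \<subseteq> W" using YW sub by (simp add: span_minimal)
  define V where "V = {x \<in> W. \<forall>y\<in>Y. ip x y = 0}"
  have subV: "subspace V" unfolding V_def subspace_def
    using sub by (auto simp: ip_add_left ip_scale_left subspace_add subspace_scale subspace_0)
  obtain B where B: "finite B" "orthonormal B" "span B = V"
    using subspace_orthonormal_basis[OF F(1) subV] F(2) by (auto simp: V_def)
  have "V = {0}"
  proof (rule ccontr)
    assume V0: "V \<noteq> {0}"
    have VW: "V \<subseteq> W" by (auto simp: V_def)
    have invV: "T x \<in> V" if x: "x \<in> V" for x
    proof -
      have xW: "x \<in> W" and xY: "\<And>y. y \<in> Y \<Longrightarrow> ip x y = 0" using x by (auto simp: V_def)
      have "ip (T x) y = 0" if y: "y \<in> Y" for y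
      proof -
        obtain r where r: "T y = r *\<^sub>R y" using Y y by (auto simp: P_def)
        have "ip (T x) y = ip x (T y)" using sym xW y YW by blast
        then show ?thesis using xY y r by (simp add: ip_scaleR_right)
      qed
      then show ?thesis using inv xW by (auto simp: V_def)
    qed
    have linV: "linear_map_on V T" using lin VW unfolding linear_map_on_def by blast
    obtain y r where y: "y \<in> V" "norm y = 1" "T y = r *\<^sub>R y"
      using symmetric_eigenvector_exists[OF B(1) B(3)[symmetric] V0 linV] invV sym VW
      by (metis subsetD)
    have yY: "ip y z = 0" "ip z y = 0" if "z \<in> Y" for z
      using y(1) that ip_eq_0_commute[of z y] by (auto simp: V_def)
    have yY': "y \<notin> Y" using yY(1)[of y] y(2) by (metis ip_self_eq_0 norm_zero zero_neq_one)
    moreover have "P (insert y Y)"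
      using Y y VW yY yY' by (auto simp: P_def orthonormal_def ip_self)
    ultimately show False using max[of "insert y Y"] fin by simp
  qed
  moreover have "x - proj Y x \<in> V" if "x \<in> W" for x
    using that spW proj_in_span[of Y x] sub fin on
    by (auto simp: V_def ip_diff_left ip_proj_basis intro!: subspace_diff)
  ultimately have "W \<subseteq> span Y" using proj_in_span by (metis subsetI eq_iff_diff_eq_0 singletonD)
  then show ?thesis using that[of Y] fin on spW Y by (auto simp: P_def)
qed

end

section \<open>Positive contractions and the strong operator topology\<close>

context hilbert_space
begin

lemma pos_ballD:
  assumes "A \<in> pos_ball"
  shows "blinfun_apply A (scale c x) = scale c (blinfun_apply A x)"
    and "ip (blinfun_apply A x) y = ip x (blinfun_apply A y)"
  using assms by (auto simp: pos_ball_def bounded_ops_def self_adjoint_def)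

lemma pos_ball_form:
  assumes "A \<in> pos_ball"
  obtains r where "0 \<le> r" "r \<le> (norm x)\<^sup>2" "ip (blinfun_apply A x) x = of_real r"
proof (cases "x = 0")
  case True
  then show ?thesis using that[of 0] by simp
next
  case False
  let ?y = "(1 / norm x) *\<^sub>R x"
  have "norm ?y \<le> 1" by simp
  then obtain r where r: "r \<in> {0..1}" "ip (blinfun_apply A ?y) ?y = of_real r"
    using assms unfolding pos_ball_def by blast
  have x: "x = norm x *\<^sub>R ?y" using False by simp
  have "ip (blinfun_apply A (norm x *\<^sub>R ?y)) (norm x *\<^sub>R ?y) = of_real ((norm x)\<^sup>2 * r)"
    by (simp only: blinfun.scaleR_right[of A "norm x" ?y] ip_scaleR_left[of "norm x"]
        ip_scaleR_right[of _ "norm x"] r(2)) (simp add: power2_eq_square)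
  then show ?thesis using that[of "(norm x)\<^sup>2 * r"] r(1) x by (simp add: mult_left_le)
qed

text \<open>With \<open>y = A x\<close>, positivity of the form at \<open>x - y\<close> reads
  \<open>0 \<le> \<langle>A x, x\<rangle> - 2 \<parallel>y\<parallel>\<^sup>2 + \<langle>A y, y\<rangle> \<le> \<parallel>x\<parallel>\<^sup>2 - \<parallel>y\<parallel>\<^sup>2\<close>.\<close>

lemma pos_ball_contraction:
  assumes "A \<in> pos_ball"
  shows "norm (blinfun_apply A x) \<le> norm x"
proof -
  define y where "y = blinfun_apply A x"
  obtain r where r: "0 \<le> r" "r \<le> (norm x)\<^sup>2" "ip (blinfun_apply A x) x = of_real r"
    using pos_ball_form[OF assms] by blast
  obtain s where s: "0 \<le> s" "s \<le> (norm y)\<^sup>2" "ip (blinfun_apply A y) y = of_real s"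
    using pos_ball_form[OF assms] by blast
  obtain t where t: "0 \<le> t" "ip (blinfun_apply A (x - y)) (x - y) = of_real t"
    using pos_ball_form[OF assms] by blast
  have "ip (blinfun_apply A y) x = of_real ((norm y)\<^sup>2)"
    using pos_ballD(2)[OF assms, of y x] by (simp add: y_def ip_self)
  moreover have "ip (blinfun_apply A x) y = of_real ((norm y)\<^sup>2)"
    by (simp only: y_def[symmetric] ip_self)
  ultimately have "(of_real t :: 'k) = of_real (r - (norm y)\<^sup>2 - ((norm y)\<^sup>2 - s))"
    unfolding t(2)[symmetric] by (simp add: blinfun.diff_right ip_diff_left ip_diff_right r(3) s(3))
  then have "t = r - (norm y)\<^sup>2 - ((norm y)\<^sup>2 - s)" by (simp only: of_real_eq_iff)
  then have "(norm y)\<^sup>2 \<le> (norm x)\<^sup>2" using t r s by linarith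
  then show ?thesis unfolding y_def by (simp add: power2_le_iff_abs_le)
qed

definition nbhd :: "('h \<Rightarrow>\<^sub>L 'h) \<Rightarrow> 'h set \<Rightarrow> real \<Rightarrow> ('h \<Rightarrow>\<^sub>L 'h) set" where
  "nbhd A F \<epsilon> = {B \<in> pos_ball. \<forall>x\<in>F. norm (blinfun_apply B x - blinfun_apply A x) < \<epsilon>}"

lemma nbhd_mono: "F' \<subseteq> F \<Longrightarrow> \<epsilon> \<le> \<epsilon>' \<Longrightarrow> nbhd A F \<epsilon> \<subseteq> nbhd A F' \<epsilon>'"
  unfolding nbhd_def by force

abbreviation pos_ball_sot :: "('h \<Rightarrow>\<^sub>L 'h) topology" where
  "pos_ball_sot \<equiv> subtopology sot pos_ball"

lemma topspace_pos_ball_sot: "topspace pos_ball_sot = pos_ball"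
  by (auto simp: topspace_sot pos_ball_def)

lemma pos_ball_sot_eq: "pos_ball_sot = subtopology strong_operator_topology pos_ball"
proof -
  have "bounded_ops \<inter> pos_ball = pos_ball" by (auto simp: pos_ball_def)
  then show ?thesis by (simp add: sot_eq subtopology_subtopology)
qed

text \<open>Together with \<open>openin_pos_ball_sotI\<close>: the sets \<open>nbhd A F \<epsilon>\<close> with finite \<open>F\<close> form a
  neighbourhood base at \<open>A\<close>, so that everything below can be argued with finitely many test
  vectors. The base comes from the product topology on functions.\<close>

lemma nbhd_subset_openin:
  assumes "openin pos_ball_sot U" "A \<in> U"
  obtains F \<epsilon> where "finite F" "\<epsilon> > 0" "nbhd A F \<epsilon> \<subseteq> U"
proof -
  obtain V where V: "openin strong_operator_topology V" "U = V \<inter> pos_ball"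
    using assms(1) unfolding pos_ball_sot_eq openin_subtopology by blast
  obtain O' where O: "open O'" "V = blinfun_apply -` O'"
    using V(1) unfolding strong_operator_topology_def openin_pullback_topology by auto
  have "openin (product_topology (\<lambda>i::'h. euclidean :: 'h topology) UNIV) O'"
    using O(1) unfolding open_fun_def by simp
  moreover have "blinfun_apply A \<in> O'" using assms(2) V O by auto
  ultimately obtain X where X: "blinfun_apply A \<in> (\<Pi>\<^sub>E i\<in>UNIV. X i)"
      "\<forall>i. openin (euclidean :: 'h topology) (X i)"
      "finite {i. X i \<noteq> topspace (euclidean :: 'h topology)}" "(\<Pi>\<^sub>E i\<in>UNIV. X i) \<subseteq> O'"
    using product_topology_open_contains_basis[of "\<lambda>i::'h. euclidean :: 'h topology" UNIV O' "blinfun_apply A"]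
    by blast
  define F where "F = {i. X i \<noteq> UNIV}"
  have F: "finite F" using X(3) by (simp add: F_def)
  have "\<exists>e>0. ball (blinfun_apply A i) e \<subseteq> X i" for i
    using X(1,2) open_contains_ball[of "X i"] by (auto simp: PiE_def Pi_def)
  then obtain e where e: "\<And>i. e i > 0" "\<And>i. ball (blinfun_apply A i) (e i) \<subseteq> X i" by metis
  define \<epsilon> where "\<epsilon> = Min (insert 1 (e ` F))"
  have "\<epsilon> > 0" using F e(1) by (auto simp: \<epsilon>_def)
  moreover have "nbhd A F \<epsilon> \<subseteq> U"
  proof
    fix B assume B: "B \<in> nbhd A F \<epsilon>"
    have "blinfun_apply B i \<in> X i" for i
    proof (cases "i \<in> F")
      case True
      have "\<epsilon> \<le> e i" using True F by (simp add: \<epsilon>_def)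
      then have "blinfun_apply B i \<in> ball (blinfun_apply A i) (e i)"
        using B True by (auto simp: nbhd_def dist_norm norm_minus_commute)
      then show ?thesis using e(2) by blast
    qed (simp add: F_def)
    then have "blinfun_apply B \<in> O'" using X(4) by (auto simp: PiE_def Pi_def)
    then show "B \<in> U" using B V O by (auto simp: nbhd_def)
  qed
  ultimately show ?thesis using that F by blast
qed

lemma openin_pos_ball_sotI:
  assumes "U \<subseteq> pos_ball" "\<And>A. A \<in> U \<Longrightarrow> \<exists>F \<epsilon>. finite F \<and> \<epsilon> > 0 \<and> nbhd A F \<epsilon> \<subseteq> U"
  shows "openin pos_ball_sot U"
proof (subst openin_subopen, intro ballI)
  fix A assume A: "A \<in> U"
  then obtain F \<epsilon> where F: "finite F" "\<epsilon> > 0" "nbhd A F \<epsilon> \<subseteq> U" using assms(2) by blast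
  have "nbhd A F \<epsilon> = pos_ball \<inter> {B. \<forall>x\<in>F. blinfun_apply B x \<in> ball (blinfun_apply A x) \<epsilon>}"
    by (auto simp: nbhd_def dist_norm norm_minus_commute)
  moreover have "openin strong_operator_topology
      {B. \<forall>x\<in>F. blinfun_apply B x \<in> ball (blinfun_apply A x) \<epsilon>}"
    using strong_operator_topology_basis[OF F(1), of "\<lambda>x. ball (blinfun_apply A x) \<epsilon>" "\<lambda>x. x"] by simp
  ultimately have "openin pos_ball_sot (nbhd A F \<epsilon>)"
    unfolding pos_ball_sot_eq openin_subtopology_alt by blast
  moreover have "A \<in> nbhd A F \<epsilon>" using A assms(1) F(2) by (auto simp: nbhd_def)
  ultimately show "\<exists>T. openin pos_ball_sot T \<and> A \<in> T \<and> T \<subseteq> U" using F(3) by blast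
qed

section \<open>Approximately cyclic vectors\<close>

definition krylov :: "('h \<Rightarrow>\<^sub>L 'h) \<Rightarrow> 'h \<Rightarrow> 'h set" where
  "krylov A v = span (range (\<lambda>n::nat. (blinfun_apply A ^^ n) v))"

lemma krylov_power: "(blinfun_apply A ^^ n) v \<in> krylov A v"
  unfolding krylov_def by (intro span_base) auto

lemma subspace_krylov: "subspace (krylov A v)"
  by (simp add: krylov_def)

lemma krylov_self: "v \<in> krylov A v"
  using krylov_power[of 0 A v] by simp

lemma krylov_invariant:
  assumes "A \<in> pos_ball" "x \<in> krylov A v"
  shows "blinfun_apply A x \<in> krylov A v"
  using assms(2) unfolding krylov_def
proof (induction rule: span_induct_alt)
  case (step c x y)
  then obtain n where "x = (blinfun_apply A ^^ n) v" by auto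
  then have "blinfun_apply A x \<in> krylov A v" using krylov_power[of "Suc n" A v] by simp
  then show ?case using step
    by (simp add: blinfun.add_right pos_ballD(1)[OF assms(1)] krylov_def span_add span_scale)
qed (simp add: span_zero)

lemma krylov_least:
  assumes "A \<in> pos_ball" "subspace W" "\<And>x. x \<in> W \<Longrightarrow> blinfun_apply A x \<in> W" "v \<in> W"
  shows "krylov A v \<subseteq> W"
proof -
  have "(blinfun_apply A ^^ n) v \<in> W" for n using assms(3,4) by (induction n) auto
  then show ?thesis unfolding krylov_def by (intro span_minimal assms(2)) auto
qed

text \<open>The map \<open>(B, v) \<mapsto> B\<^sup>n v\<close> is jointly continuous on the unit ball because multiplication of
  operators is: \<open>B\<^sup>n\<^sup>+\<^sup>1 v' - A\<^sup>n\<^sup>+\<^sup>1 v = B (B\<^sup>n v' - A\<^sup>n v) + (B - A) A\<^sup>n v\<close> with \<open>\<parallel>B\<parallel> \<le> 1\<close>.\<close>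

lemma power_jointly_continuous:
  assumes "\<eta> > 0"
  shows "\<exists>F \<epsilon>. finite F \<and> \<epsilon> > 0 \<and> (\<forall>B \<in> nbhd A F \<epsilon>. \<forall>v'. norm (v' - v) < \<epsilon> \<longrightarrow>
           norm ((blinfun_apply B ^^ n) v' - (blinfun_apply A ^^ n) v) < \<eta>)"
  using assms
proof (induction n arbitrary: \<eta>)
  case 0
  then show ?case by (intro exI[of _ "{}"] exI[of _ \<eta>]) auto
next
  case (Suc n)
  obtain F \<epsilon> where F: "finite F" "\<epsilon> > 0"
    and IH: "\<And>B v'. B \<in> nbhd A F \<epsilon> \<Longrightarrow> norm (v' - v) < \<epsilon> \<Longrightarrow>
      norm ((blinfun_apply B ^^ n) v' - (blinfun_apply A ^^ n) v) < \<eta> / 2"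
    using Suc.IH[of "\<eta> / 2"] Suc.prems by (metis half_gt_zero)
  let ?a = "(blinfun_apply A ^^ n) v"
  show ?case
  proof (intro exI conjI ballI allI impI)
    show "finite (insert ?a F)" "min \<epsilon> (\<eta> / 2) > 0" using F Suc.prems by auto
    fix B v' assume B: "B \<in> nbhd A (insert ?a F) (min \<epsilon> (\<eta> / 2))" and v': "norm (v' - v) < min \<epsilon> (\<eta> / 2)"
    let ?b = "(blinfun_apply B ^^ n) v'"
    have Bp: "B \<in> pos_ball" using B by (simp add: nbhd_def)
    have "B \<in> nbhd A F \<epsilon>" using B nbhd_mono[of F "insert ?a F" "min \<epsilon> (\<eta> / 2)" \<epsilon> A] by auto
    then have 1: "norm (blinfun_apply B (?b - ?a)) < \<eta> / 2"
      using pos_ball_contraction[OF Bp, of "?b - ?a"] IH[of B v'] v' by auto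
    have 2: "norm (blinfun_apply B ?a - blinfun_apply A ?a) < \<eta> / 2" using B by (auto simp: nbhd_def)
    have "blinfun_apply B ?b - blinfun_apply A ?a
        = blinfun_apply B (?b - ?a) + (blinfun_apply B ?a - blinfun_apply A ?a)"
      by (simp add: blinfun.diff_right)
    then have "norm (blinfun_apply B ?b - blinfun_apply A ?a) < \<eta>"
      using 1 2 by (simp only:) (rule norm_triangle_lt, linarith)
    then show "norm ((blinfun_apply B ^^ Suc n) v' - (blinfun_apply A ^^ Suc n) v) < \<eta>" by simp
  qed
qed

text \<open>An element of the span involves finitely many powers; the same linear combination of the
  powers of a nearby operator, applied to a nearby vector, stays close.\<close>

lemma krylov_lower_semicontinuous:
  assumes "k \<in> krylov A v" "\<eta> > 0"
  shows "\<exists>F \<epsilon>. finite F \<and> \<epsilon> > 0 \<and> (\<forall>B \<in> nbhd A F \<epsilon>. \<forall>v'. norm (v' - v) < \<epsilon> \<longrightarrow>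
           (\<exists>k'\<in>krylov B v'. norm (k' - k) < \<eta>))"
  using assms unfolding krylov_def[of A]
proof (induction arbitrary: \<eta> rule: span_induct_alt)
  case base
  then show ?case
    by (intro exI[of _ "{}"] exI[of _ 1])
      (auto intro!: bexI[of _ 0] simp: subspace_0[OF subspace_krylov])
next
  case (step c x y)
  then obtain n where n: "x = (blinfun_apply A ^^ n) v" by auto
  obtain F \<epsilon> where F: "finite F" "\<epsilon> > 0"
    and 1: "\<And>B v'. B \<in> nbhd A F \<epsilon> \<Longrightarrow> norm (v' - v) < \<epsilon> \<Longrightarrow> \<exists>k'\<in>krylov B v'. norm (k' - y) < \<eta> / 2"
    using step.IH[of "\<eta> / 2"] step.prems by (metis half_gt_zero)
  define d where "d = \<eta> / (2 * (norm c + 1))"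
  have c1: "norm c + 1 > 0" by (simp add: add_nonneg_pos)
  then have d: "d > 0" using step.prems by (simp add: d_def)
  obtain F' \<epsilon>' where F': "finite F'" "\<epsilon>' > 0"
    and 2: "\<And>B v'. B \<in> nbhd A F' \<epsilon>' \<Longrightarrow> norm (v' - v) < \<epsilon>' \<Longrightarrow>
      norm ((blinfun_apply B ^^ n) v' - x) < d"
    using power_jointly_continuous[OF d, of A v n] unfolding n by metis
  show ?case
  proof (intro exI conjI ballI allI impI)
    show "finite (F \<union> F')" "min \<epsilon> \<epsilon>' > 0" using F F' by auto
    fix B v' assume B: "B \<in> nbhd A (F \<union> F') (min \<epsilon> \<epsilon>')" and v': "norm (v' - v) < min \<epsilon> \<epsilon>'"
    have B': "B \<in> nbhd A F \<epsilon>" "B \<in> nbhd A F' \<epsilon>'"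
      using B nbhd_mono[of F "F \<union> F'" "min \<epsilon> \<epsilon>'" \<epsilon> A] nbhd_mono[of F' "F \<union> F'" "min \<epsilon> \<epsilon>'" \<epsilon>' A] by auto
    obtain k where k: "k \<in> krylov B v'" "norm (k - y) < \<eta> / 2" using 1[OF B'(1), of v'] v' by auto
    let ?p = "(blinfun_apply B ^^ n) v'"
    have "norm (?p - x) < d" using 2[OF B'(2), of v'] v' by simp
    then have "norm (scale c (?p - x)) \<le> norm c * d" by (simp add: norm_scale mult_left_mono)
    also have "\<dots> \<le> (norm c + 1) * d" using d by simp
    also have "\<dots> = \<eta> / 2" using c1 by (simp add: d_def field_simps)
    finally have "norm (scale c ?p + k - (scale c x + y)) < \<eta>"
      using norm_triangle_ineq[of "scale c (?p - x)" "k - y"] k(2)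
      by (simp add: scale_right_diff_distrib algebra_simps)
    moreover have "scale c ?p + k \<in> krylov B v'"
      using k(1) krylov_power by (intro subspace_add subspace_scale subspace_krylov)
    ultimately show "\<exists>k'\<in>krylov B v'. norm (k' - (scale c x + y)) < \<eta>" by blast
  qed
qed

definition approx_cyclic :: "'h set \<Rightarrow> 'h \<Rightarrow> real \<Rightarrow> ('h \<Rightarrow>\<^sub>L 'h) set" where
  "approx_cyclic F w \<epsilon> =
     {A \<in> pos_ball. \<forall>v \<in> span F. norm v = 1 \<longrightarrow> (\<exists>k \<in> krylov A v. norm (k - w) < \<epsilon>)}"

text \<open>The unit sphere of a finite-dimensional space is compact, so finitely many of the
  neighbourhoods provided by lower semicontinuity serve all of its vectors at once.\<close>

lemma openin_approx_cyclic:
  assumes "finite F"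
  shows "openin pos_ball_sot (approx_cyclic F w \<epsilon>)"
proof (rule openin_pos_ball_sotI)
  show "approx_cyclic F w \<epsilon> \<subseteq> pos_ball" by (auto simp: approx_cyclic_def)
  fix A assume A: "A \<in> approx_cyclic F w \<epsilon>"
  let ?K = "{v \<in> span F. norm v = 1}"
  define good where "good v I d \<longleftrightarrow> finite I \<and> d > 0 \<and> (\<forall>B \<in> nbhd A I d. \<forall>v'. norm (v' - v) < d \<longrightarrow>
      (\<exists>k \<in> krylov B v'. norm (k - w) < \<epsilon>))" for v I d
  have "\<exists>I d. good v I d" if v: "v \<in> ?K" for v
  proof -
    obtain k where k: "k \<in> krylov A v" "norm (k - w) < \<epsilon>" using A v by (auto simp: approx_cyclic_def)
    then obtain I d where I: "finite I" "d > 0"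
      and *: "\<And>B v'. B \<in> nbhd A I d \<Longrightarrow> norm (v' - v) < d \<Longrightarrow>
          \<exists>k'\<in>krylov B v'. norm (k' - k) < \<epsilon> - norm (k - w)"
      using krylov_lower_semicontinuous[OF k(1), of "\<epsilon> - norm (k - w)"] by (metis diff_gt_0_iff_gt)
    have "\<exists>k \<in> krylov B v'. norm (k - w) < \<epsilon>" if B: "B \<in> nbhd A I d" "norm (v' - v) < d" for B v'
    proof -
      obtain k' where k': "k' \<in> krylov B v'" "norm (k' - k) < \<epsilon> - norm (k - w)" using *[OF B] by blast
      have "norm (k' - w) \<le> norm (k' - k) + norm (k - w)"
        using norm_triangle_ineq[of "k' - k" "k - w"] by simp
      then show ?thesis using k' by (intro bexI[of _ k']) auto
    qed
    then show ?thesis using I unfolding good_def by blast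
  qed
  then obtain I d where good: "\<And>v. v \<in> ?K \<Longrightarrow> good v (I v) (d v)" by metis
  then have I: "\<And>v. v \<in> ?K \<Longrightarrow> finite (I v)" "\<And>v. v \<in> ?K \<Longrightarrow> d v > 0"
    and near: "\<And>v B v'. v \<in> ?K \<Longrightarrow> B \<in> nbhd A (I v) (d v) \<Longrightarrow> norm (v' - v) < d v \<Longrightarrow>
        \<exists>k \<in> krylov B v'. norm (k - w) < \<epsilon>"
    unfolding good_def by blast+
  obtain C where C: "C \<subseteq> ?K" "finite C" "?K \<subseteq> (\<Union>v\<in>C. ball v (d v))"
  proof (rule compactE_image[OF compact_unit_sphere[OF assms], of ?K "\<lambda>v. ball v (d v)"])
    show "?K \<subseteq> (\<Union>v\<in>?K. ball v (d v))" using I(2) by force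
  qed auto
  define e where "e = Min (insert 1 (d ` C))"
  have "finite (\<Union>v\<in>C. I v)" "e > 0" using C I by (auto simp: e_def)
  moreover have "nbhd A (\<Union>v\<in>C. I v) e \<subseteq> approx_cyclic F w \<epsilon>"
  proof
    fix B assume B: "B \<in> nbhd A (\<Union>v\<in>C. I v) e"
    have "\<exists>k \<in> krylov B v'. norm (k - w) < \<epsilon>" if v': "v' \<in> ?K" for v'
    proof -
      obtain v where v: "v \<in> C" "v' \<in> ball v (d v)" using v' C(3) by blast
      have "e \<le> d v" using v(1) C(2) by (simp add: e_def)
      then have "B \<in> nbhd A (I v) (d v)" using B v(1) nbhd_mono[of "I v" "\<Union>v\<in>C. I v" e "d v" A] by auto
      then show ?thesis using near[of v B v'] v C(1) by (auto simp: dist_norm norm_minus_commute)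
    qed
    then show "B \<in> approx_cyclic F w \<epsilon>" using B by (auto simp: approx_cyclic_def nbhd_def)
  qed
  ultimately show "\<exists>F' e. finite F' \<and> e > 0 \<and> nbhd A F' e \<subseteq> approx_cyclic F w \<epsilon>" by blast
qed

text \<open>Passing to a unit vector changes nothing, since \<open>v / \<parallel>v\<parallel>\<close> lies in the span of the orbit
  of \<open>v\<close>.\<close>

lemma cyclic_of_approx_cyclic:
  assumes dense: "closure D = UNIV" and v: "v \<in> span F" "v \<noteq> 0"
    and A: "\<And>w n. w \<in> D \<Longrightarrow> A \<in> approx_cyclic F w (inverse (real (Suc n)))"
  shows "cyclic A v"
proof -
  let ?u = "(1 / norm v) *\<^sub>R v"
  have u: "?u \<in> span F" "norm ?u = 1" using v by (auto intro: subspace_scaleR)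
  have "D \<noteq> {}" using dense by auto
  then have Ap: "A \<in> pos_ball" using A by (auto simp: approx_cyclic_def)
  have sub: "krylov A ?u \<subseteq> krylov A v"
    using krylov_invariant[OF Ap] by (intro krylov_least[OF Ap] subspace_krylov subspace_scaleR krylov_self)
  have "w \<in> closure (krylov A v)" if w: "w \<in> D" for w
  proof (unfold closure_approachable, intro allI impI)
    fix e :: real assume "e > 0"
    then obtain n where n: "inverse (real (Suc n)) < e" using reals_Archimedean by blast
    obtain k where "k \<in> krylov A ?u" "norm (k - w) < inverse (real (Suc n))"
      using A[OF w, of n] u by (auto simp: approx_cyclic_def)
    then show "\<exists>y\<in>krylov A v. dist y w < e" using sub n by (force simp: dist_norm)
  qed
  then have "closure D \<subseteq> closure (krylov A v)" by (intro closure_minimal) auto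
  then show ?thesis using dense unfolding cyclic_def krylov_def by auto
qed

end

section \<open>Three-term recurrences and power sums\<close>

text \<open>The solutions of the recurrence are the combinations of \<open>cos (k \<theta>)\<close> and \<open>sin (k \<theta>)\<close>, to which
  the addition theorem applies; arguing from the recurrence also covers the degenerate case
  \<open>cos \<theta> = \<plusminus>1\<close>.\<close>

lemma three_term_symmetric_sum:
  fixes z :: "nat \<Rightarrow> 'k::real_normed_field"
  assumes rec: "\<And>k. k + 2 \<le> N \<Longrightarrow> z (k + 2) = of_real (2 * cos \<theta>) * z (k + 1) - z k"
    and "p + j \<le> N" "j \<le> p"
  shows "z (p - j) + z (p + j) = of_real (2 * cos (real j * \<theta>)) * z p"
  using assms(2,3)
proof (induction j rule: induct_nat_012)
  case 0
  then show ?case by simp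
next
  case 1
  then have "z (p + 1) = of_real (2 * cos \<theta>) * z p - z (p - 1)"
    using rec[of "p - 1"] by simp
  then show ?case by simp
next
  case (ge2 j)
  have 1: "z (p + (j + 2)) = of_real (2 * cos \<theta>) * z (p + (j + 1)) - z (p + j)"
    using rec[of "p + j"] ge2.prems by (simp add: add.assoc)
  have "p - (j + 2) + 2 = p - j" "p - (j + 2) + 1 = p - (j + 1)" using ge2.prems by auto
  then have 2: "z (p - (j + 2)) = of_real (2 * cos \<theta>) * z (p - (j + 1)) - z (p - j)"
    using rec[of "p - (j + 2)"] ge2.prems by simp
  have 3: "cos (real (j + 2) * \<theta>) = 2 * cos \<theta> * cos (real (j + 1) * \<theta>) - cos (real j * \<theta>)"
    using cos_add[of "real (j + 1) * \<theta>" \<theta>] cos_diff[of "real (j + 1) * \<theta>" \<theta>]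
    by (simp add: algebra_simps)
  have "z (p - (j + 2)) + z (p + (j + 2))
      = of_real (2 * cos \<theta>) * (z (p - (j + 1)) + z (p + (j + 1))) - (z (p - j) + z (p + j))"
    unfolding 1 2 by (simp add: algebra_simps)
  also have "\<dots> = of_real (2 * cos \<theta>) * (of_real (2 * cos (real (j + 1) * \<theta>)) * z p)
      - of_real (2 * cos (real j * \<theta>)) * z p"
    using ge2.IH ge2.prems by simp
  also have "\<dots> = of_real (2 * cos (real (j + 2) * \<theta>)) * z p"
    unfolding 3 by (simp add: algebra_simps)
  finally show ?case by simp
qed

text \<open>With \<open>c = 2 cos \<theta>\<close> the previous identity at \<open>p = i + j\<close> reads
  \<open>z i = 2 cos (j \<theta>) z (i + j) - z (i + 2 j)\<close>: a single value is controlled by two later ones,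
  for every \<open>j\<close>. Averaging the squares over \<open>j\<close> makes it small.\<close>

lemma three_term_value_bound:
  fixes z :: "nat \<Rightarrow> 'k::real_normed_field"
  assumes c: "\<bar>c\<bar> \<le> 2"
    and rec: "\<And>k. k + 2 \<le> N \<Longrightarrow> z (k + 2) = of_real c * z (k + 1) - z k"
    and sum: "(\<Sum>k\<le>N. (norm (z k))\<^sup>2) \<le> 1" and i: "i + 2 * n \<le> N"
  shows "real n * (norm (z i))\<^sup>2 \<le> 10"
proof -
  obtain \<theta> where \<theta>: "c = 2 * cos \<theta>"
    using c by (intro that[of "arccos (c / 2)"]) (simp add: cos_arccos_abs)
  have part: "(\<Sum>j\<in>{1..n}. (norm (z (f j)))\<^sup>2) \<le> 1"
    if f: "inj_on f {1..n}" "f ` {1..n} \<subseteq> {..N}" for f :: "nat \<Rightarrow> nat"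
  proof -
    have "(\<Sum>j\<in>{1..n}. (norm (z (f j)))\<^sup>2) = (\<Sum>k\<in>f ` {1..n}. (norm (z k))\<^sup>2)"
      using f(1) by (simp add: sum.reindex)
    also have "\<dots> \<le> (\<Sum>k\<le>N. (norm (z k))\<^sup>2)" using f(2) by (intro sum_mono2) auto
    finally show ?thesis using sum by simp
  qed
  \<comment> \<open>The constants come from \<open>(2 p + q)\<^sup>2 \<le> 2 (2 p)\<^sup>2 + 2 q\<^sup>2\<close>.\<close>
  have "(norm (z i))\<^sup>2 \<le> 8 * (norm (z (i + j)))\<^sup>2 + 2 * (norm (z (i + 2 * j)))\<^sup>2" if j: "j \<in> {1..n}" for j
  proof -
    have "z (i + j - j) + z (i + j + j) = of_real (2 * cos (real j * \<theta>)) * z (i + j)"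
      using j i rec unfolding \<theta> by (intro three_term_symmetric_sum[where N = N]) auto
    moreover have "i + j - j = i" "i + j + j = i + 2 * j" by auto
    ultimately have "z i + z (i + 2 * j) = of_real (2 * cos (real j * \<theta>)) * z (i + j)" by metis
    then have "z i = of_real (2 * cos (real j * \<theta>)) * z (i + j) - z (i + 2 * j)"
      by (simp only: eq_diff_eq)
    then have "norm (z i) \<le> norm (of_real (2 * cos (real j * \<theta>)) * z (i + j)) + norm (z (i + 2 * j))"
      by (metis norm_triangle_ineq4)
    also have "norm (of_real (2 * cos (real j * \<theta>)) * z (i + j)) \<le> 2 * norm (z (i + j))"
      unfolding norm_mult norm_of_real
      using abs_cos_le_one[of "real j * \<theta>"] by (intro mult_right_mono) (auto simp: abs_mult)
    finally have "norm (z i) \<le> 2 * norm (z (i + j)) + norm (z (i + 2 * j))" by simp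
    then have "(norm (z i))\<^sup>2 \<le> (2 * norm (z (i + j)) + norm (z (i + 2 * j)))\<^sup>2"
      by (simp add: power_mono)
    also have "\<dots> \<le> 8 * (norm (z (i + j)))\<^sup>2 + 2 * (norm (z (i + 2 * j)))\<^sup>2"
      using zero_le_power2[of "2 * norm (z (i + j)) - norm (z (i + 2 * j))"]
      by (simp add: power2_eq_square algebra_simps)
    finally show ?thesis .
  qed
  then have "(\<Sum>j\<in>{1..n}. (norm (z i))\<^sup>2)
      \<le> (\<Sum>j\<in>{1..n}. 8 * (norm (z (i + j)))\<^sup>2 + 2 * (norm (z (i + 2 * j)))\<^sup>2)"
    by (rule sum_mono)
  also have "\<dots> = 8 * (\<Sum>j\<in>{1..n}. (norm (z (i + j)))\<^sup>2) + 2 * (\<Sum>j\<in>{1..n}. (norm (z (i + 2 * j)))\<^sup>2)"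
    by (simp add: sum.distrib sum_distrib_left)
  also have "\<dots> \<le> 8 * 1 + 2 * 1"
    using i by (intro add_mono mult_left_mono part) (auto simp: inj_on_def)
  finally show ?thesis by simp
qed

text \<open>Vandermonde for distinct nodes: the hypothesis extends from powers to all polynomials.\<close>

lemma power_sums_zero_imp_zero:
  fixes x :: "'i \<Rightarrow> 'k::real_normed_field" and \<mu> :: "'i \<Rightarrow> real"
  assumes fin: "finite I" and inj: "inj_on \<mu> I"
    and zero: "\<And>j. (\<Sum>i\<in>I. of_real (\<mu> i ^ j) * x i) = 0" and i: "i \<in> I"
  shows "x i = 0"
proof -
  have poly: "(\<Sum>i\<in>I. of_real (poly p (\<mu> i)) * x i) = 0" for p
  proof -
    have "(\<Sum>i\<in>I. of_real (poly p (\<mu> i)) * x i)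
        = (\<Sum>i\<in>I. \<Sum>j\<le>degree p. of_real (coeff p j) * (of_real (\<mu> i ^ j) * x i))"
      by (simp add: poly_altdef sum_distrib_right mult.assoc)
    also have "\<dots> = (\<Sum>j\<le>degree p. of_real (coeff p j) * (\<Sum>i\<in>I. of_real (\<mu> i ^ j) * x i))"
      by (subst sum.swap) (simp add: sum_distrib_left)
    finally show ?thesis by (simp only: zero) simp
  qed
  \<comment> \<open>The Lagrange polynomial that vanishes at all nodes other than \<open>\<mu> i\<close>.\<close>
  define p where "p = (\<Prod>k\<in>I - {i}. [:- \<mu> k, 1:])"
  have 0: "poly p (\<mu> k) = 0" if "k \<in> I - {i}" for k
    using that fin by (auto simp: p_def poly_prod)
  have "(\<Sum>k\<in>I. of_real (poly p (\<mu> k)) * x k) = of_real (poly p (\<mu> i)) * x i"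
    using fin i 0 by (simp add: sum.remove[of I i])
  moreover have "poly p (\<mu> i) \<noteq> 0"
    using inj i fin by (auto simp: p_def poly_prod inj_on_def)
  ultimately show ?thesis using poly[of p] by simp
qed

lemma injective_choice_from_infinite_sets:
  assumes "finite I" "\<And>i. i \<in> I \<Longrightarrow> infinite (S i)"
  obtains f where "inj_on f I" "\<And>i. i \<in> I \<Longrightarrow> f i \<in> S i"
proof -
  have "\<exists>f. inj_on f I \<and> (\<forall>i\<in>I. f i \<in> S i)" using assms
  proof (induction I)
    case (insert a I)
    then obtain f where f: "inj_on f I" "\<forall>i\<in>I. f i \<in> S i" by auto
    have "infinite (S a - f ` I)" using insert.prems insert.hyps by (intro Diff_infinite_finite) auto
    then obtain b where b: "b \<in> S a - f ` I" using infinite_imp_nonempty by blast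
    have "inj_on (f(a := b)) (insert a I)" using f b insert.hyps by (auto simp: inj_on_def)
    moreover have "\<forall>i\<in>insert a I. (f(a := b)) i \<in> S i" using f b by auto
    ultimately show ?case by blast
  qed auto
  then show ?thesis using that by blast
qed

section \<open>Operators given by real symmetric matrices\<close>

text \<open>If \<open>c\<close> is its own conjugate then \<open>c\<^sup>2 = \<bar>c\<bar>\<^sup>2\<close>, so \<open>c = \<plusminus>\<bar>c\<bar>\<close>.\<close>

lemma cnjg_fixed_imp_real:
  fixes c :: "'k::real_or_complex"
  assumes "c = cnjg c"
  obtains r where "c = of_real r"
proof -
  have "(c - of_real (norm c)) * (c + of_real (norm c)) = c * cnjg c - of_real ((norm c)\<^sup>2)"
    by (simp add: algebra_simps power2_eq_square flip: assms)
  then have "(c - of_real (norm c)) * (c + of_real (norm c)) = 0"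
    by (simp only: mult_cnjg) (simp add: scaleR_conv_of_real)
  then have "c = of_real (norm c) \<or> c = of_real (- norm c)"
    by (auto simp: eq_neg_iff_add_eq_0)
  then show ?thesis using that by blast
qed

context hilbert_space
begin

text \<open>An indexed counterpart of \<open>orthonormal\<close>: matrices act on indices, and a sequence can be
  prolonged without renaming the vectors already chosen.\<close>

definition orthonormal_seq :: "(nat \<Rightarrow> 'h) \<Rightarrow> nat \<Rightarrow> bool" where
  "orthonormal_seq e N \<longleftrightarrow> (\<forall>i<N. \<forall>j<N. ip (e i) (e j) = (if i = j then 1 else 0))"

lemma orthonormal_seq_le: "orthonormal_seq e N \<Longrightarrow> M \<le> N \<Longrightarrow> orthonormal_seq e M"
  by (simp add: orthonormal_seq_def)

lemma orthonormal_seq_inj: "orthonormal_seq e N \<Longrightarrow> inj_on e {..<N}"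
  unfolding inj_on_def orthonormal_seq_def by (metis lessThan_iff zero_neq_one)

lemma orthonormal_seq_image: "orthonormal_seq e N \<Longrightarrow> orthonormal (e ` {..<N})"
  unfolding orthonormal_def orthonormal_seq_def by (auto) (metis zero_neq_one)+

lemma orthonormal_seq_norm: "orthonormal_seq e N \<Longrightarrow> i < N \<Longrightarrow> norm (e i) = 1"
  using orthonormal_norm[OF orthonormal_seq_image] by simp

lemma orthonormal_seq_expand:
  assumes "orthonormal_seq e N" "x \<in> span (e ` {..<N})"
  shows "x = (\<Sum>i<N. scale (ip x (e i)) (e i))"
  using orthonormal_expand[OF _ orthonormal_seq_image[OF assms(1)] assms(2)]
  by (simp add: sum.reindex[OF orthonormal_seq_inj[OF assms(1)]])

lemma orthonormal_seq_bessel: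
  assumes "orthonormal_seq e N"
  shows "(\<Sum>i<N. (norm (ip x (e i)))\<^sup>2) \<le> (norm x)\<^sup>2"
  using bessel[OF _ orthonormal_seq_image[OF assms], of x]
  by (simp add: sum.reindex[OF orthonormal_seq_inj[OF assms]])

lemma ip_sum_scale_seq:
  assumes "orthonormal_seq e N" "j < N"
  shows "ip (\<Sum>i<N. scale (c i) (e i)) (e j) = c j"
proof -
  have "ip (\<Sum>i<N. scale (c i) (e i)) (e j) = (\<Sum>i<N. if i = j then c j else 0)"
    unfolding ip_sum_left ip_scale_left
    by (rule sum.cong) (use assms in \<open>auto simp: orthonormal_seq_def\<close>)
  then show ?thesis using assms(2) by simp
qed

text \<open>Infinite dimension enters the argument only here: a Gram--Schmidt step is always possible.\<close>

lemma orthonormal_seq_extend: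
  assumes inf: "\<not> finite_dim UNIV" and e: "orthonormal_seq e m" and "m \<le> N"
  obtains e' where "orthonormal_seq e' N" "\<And>i. i < m \<Longrightarrow> e' i = e i"
proof -
  have "\<exists>e'. orthonormal_seq e' N \<and> (\<forall>i<m. e' i = e i)" using assms(3)
  proof (induction N rule: dec_induct)
    case base
    then show ?case using e by blast
  next
    case (step N)
    then obtain f where f: "orthonormal_seq f N" "\<And>i. i < m \<Longrightarrow> f i = e i" by blast
    let ?G = "f ` {..<N}"
    have G: "finite ?G" "orthonormal ?G" using orthonormal_seq_image[OF f(1)] by auto
    have "span ?G \<noteq> UNIV" using inf G(1) unfolding finite_dim_def by blast
    then obtain x where x: "x \<notin> span ?G" by blast
    define b where "b = x - proj ?G x"
    have b: "b \<noteq> 0" using x proj_in_span[of ?G x] by (auto simp: b_def)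
    define c where "c = (1 / norm b) *\<^sub>R b"
    have cf: "ip c (f i) = 0" if "i < N" for i
      using that G by (simp add: c_def b_def ip_scaleR_left ip_diff_left ip_proj_basis)
    then have fc: "ip (f i) c = 0" if "i < N" for i using that ip_eq_0_commute by blast
    have "ip c c = 1" using b by (simp add: ip_self c_def)
    then have "orthonormal_seq (f(N := c)) (Suc N)"
      using f(1) cf fc by (auto simp: orthonormal_seq_def less_Suc_eq)
    moreover have "\<forall>i<m. (f(N := c)) i = e i" using f(2) step.hyps by auto
    ultimately show ?case by blast
  qed
  then show ?thesis using that by blast
qed

definition mat_op :: "(nat \<Rightarrow> 'h) \<Rightarrow> nat \<Rightarrow> (nat \<Rightarrow> nat \<Rightarrow> real) \<Rightarrow> 'h \<Rightarrow>\<^sub>L 'h" where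
  "mat_op e N M = Blinfun (\<lambda>x. \<Sum>i<N. scale (\<Sum>j<N. of_real (M i j) * ip x (e j)) (e i))"

lemma mat_op_apply:
  "blinfun_apply (mat_op e N M) x = (\<Sum>i<N. scale (\<Sum>j<N. of_real (M i j) * ip x (e j)) (e i))"
proof -
  have "bounded_linear (\<lambda>x. \<Sum>i<N. scale (\<Sum>j<N. of_real (M i j) * ip x (e j)) (e i))"
    by (intro bounded_linear_sum bounded_linear_compose[OF bounded_linear_scale]
        bounded_linear_const_mult bounded_linear_ip_left)
  then show ?thesis unfolding mat_op_def by (simp add: bounded_linear_Blinfun_apply)
qed

lemma mat_op_basis:
  assumes "orthonormal_seq e N" "j < N"
  shows "blinfun_apply (mat_op e N M) (e j) = (\<Sum>i<N. M i j *\<^sub>R e i)"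
proof -
  have "(\<Sum>k<N. of_real (M i k) * ip (e j) (e k)) = of_real (M i j)" for i
  proof -
    have "(\<Sum>k<N. of_real (M i k) * ip (e j) (e k)) = (\<Sum>k<N. if k = j then of_real (M i j) else 0)"
      by (rule sum.cong) (use assms in \<open>auto simp: orthonormal_seq_def\<close>)
    then show ?thesis using assms(2) by simp
  qed
  then show ?thesis by (simp add: mat_op_apply scale_of_real)
qed

text \<open>Gershgorin: the off-diagonal part of the quadratic form is at most
  \<open>\<Sum>\<^sub>i R\<^sub>i \<bar>x\<^sub>i\<bar>\<^sup>2\<close>, where \<open>R\<^sub>i\<close> is the off-diagonal absolute row sum, by
  \<open>2 \<bar>x\<^sub>i\<bar> \<bar>x\<^sub>j\<bar> \<le> \<bar>x\<^sub>i\<bar>\<^sup>2 + \<bar>x\<^sub>j\<bar>\<^sup>2\<close> and symmetry.\<close>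

lemma mat_op_pos_ball:
  assumes e: "orthonormal_seq e N"
    and sym: "\<And>i j. M i j = M j i"
    and low: "\<And>i. i < N \<Longrightarrow> (\<Sum>j\<in>{..<N} - {i}. \<bar>M i j\<bar>) \<le> M i i"
    and up: "\<And>i. i < N \<Longrightarrow> (\<Sum>j\<in>{..<N} - {i}. \<bar>M i j\<bar>) \<le> 1 - M i i"
  shows "mat_op e N M \<in> pos_ball"
proof -
  let ?A = "blinfun_apply (mat_op e N M)"
  have form: "ip (?A x) y = (\<Sum>i<N. \<Sum>j<N. of_real (M i j) * (ip x (e j) * cnjg (ip y (e i))))" for x y
    unfolding mat_op_apply ip_sum_left ip_scale_left
    by (simp add: sum_distrib_right mult.assoc flip: ip_cnjg[of "e _" y])
  have sa: "ip (?A x) y = ip x (?A y)" for x y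
  proof -
    have "ip x (?A y) = cnjg (ip (?A y) x)" by (rule ip_cnjg)
    also have "\<dots> = ip x (\<Sum>i<N. scale (\<Sum>j<N. of_real (M i j) * ip y (e j)) (e i))"
      unfolding ip_cnjg[symmetric] mat_op_apply ..
    also have "\<dots> = (\<Sum>i<N. cnjg (\<Sum>j<N. of_real (M i j) * ip y (e j)) * ip x (e i))"
      by (simp add: ip_sum_right ip_scale_right)
    also have "\<dots> = (\<Sum>i<N. \<Sum>j<N. of_real (M i j) * (ip x (e i) * cnjg (ip y (e j))))"
    proof (rule sum.cong[OF refl])
      fix i
      have "cnjg (\<Sum>j\<in>J. of_real (M i j) * ip y (e j)) = (\<Sum>j\<in>J. of_real (M i j) * cnjg (ip y (e j)))"
        if "finite J" for J
        using that by (induction J) (auto simp: cnjg_add cnjg_mult)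
      then show "cnjg (\<Sum>j<N. of_real (M i j) * ip y (e j)) * ip x (e i)
          = (\<Sum>j<N. of_real (M i j) * (ip x (e i) * cnjg (ip y (e j))))"
        by (simp add: sum_distrib_left sum_distrib_right mult_ac)
    qed
    also have "\<dots> = ip (?A x) y"
      unfolding form by (subst sum.swap) (simp add: sym)
    finally show ?thesis by simp
  qed
  have bdd: "mat_op e N M \<in> bounded_ops"
    unfolding bounded_ops_def mem_Collect_eq mat_op_apply
    by (simp add: ip_scale_left scale_sum_right sum_distrib_left mult.left_commute)
  have "\<exists>r\<in>{0..1}. ip (?A v) v = of_real r" if v: "norm v \<le> 1" for v
  proof -
    define x where "x i = ip v (e i)" for i
    define n where "n i = (norm (x i))\<^sup>2" for i
    define D where "D = (\<Sum>i<N. M i i * n i)"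
    define R where "R i = (\<Sum>j\<in>{..<N} - {i}. \<bar>M i j\<bar>)" for i
    have n0: "n i \<ge> 0" for i by (simp add: n_def)
    define O' where "O' = (\<Sum>i<N. \<Sum>j\<in>{..<N} - {i}. of_real (M i j) * (x j * cnjg (x i)))"
    have split: "ip (?A v) v = of_real D + O'"
    proof -
      have "ip (?A v) v = (\<Sum>i<N. of_real (M i i) * (x i * cnjg (x i))
          + (\<Sum>j\<in>{..<N} - {i}. of_real (M i j) * (x j * cnjg (x i))))"
        unfolding form x_def by (intro sum.cong refl sum.remove) auto
      also have "\<dots> = (\<Sum>i<N. of_real (M i i * n i)) + O'"
        unfolding O'_def sum.distrib mult_cnjg n_def by (simp add: scaleR_conv_of_real)
      finally show ?thesis by (simp add: D_def)
    qed
    have "norm O' \<le> (\<Sum>i<N. \<Sum>j\<in>{..<N} - {i}. \<bar>M i j\<bar> * (n i / 2 + n j / 2))"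
      unfolding O'_def
    proof (intro order_trans[OF norm_sum] sum_mono)
      fix i j
      have "norm (x j) * norm (x i) \<le> n i / 2 + n j / 2"
        using sum_squares_bound[of "norm (x i)" "norm (x j)"] by (simp add: n_def mult_ac)
      then show "norm (of_real (M i j) * (x j * cnjg (x i))) \<le> \<bar>M i j\<bar> * (n i / 2 + n j / 2)"
        by (simp add: norm_mult mult_left_mono)
    qed
    also have "\<dots> = (\<Sum>i<N. \<Sum>j\<in>{..<N} - {i}. \<bar>M i j\<bar> * (n i / 2))
        + (\<Sum>i<N. \<Sum>j\<in>{..<N} - {i}. \<bar>M i j\<bar> * (n j / 2))"
      by (simp only: distrib_left sum.distrib)
    also have "\<dots> = (\<Sum>i<N. R i * n i)"
    proof -
      have eq: "(\<Sum>j\<in>{..<N} - {i}. f i j) = (\<Sum>j<N. if i = j then 0 else f i j)"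
        for f :: "nat \<Rightarrow> nat \<Rightarrow> real" and i
        by (rule sum.mono_neutral_cong_left) auto
      have "(\<Sum>i<N. \<Sum>j\<in>{..<N} - {i}. \<bar>M i j\<bar> * (n j / 2))
          = (\<Sum>i<N. \<Sum>j<N. if i = j then 0 else \<bar>M i j\<bar> * (n j / 2))"
        by (intro sum.cong refl eq)
      also have "\<dots> = (\<Sum>i<N. \<Sum>j<N. if j = i then 0 else \<bar>M j i\<bar> * (n i / 2))"
        by (rule sum.swap)
      also have "\<dots> = (\<Sum>i<N. \<Sum>j\<in>{..<N} - {i}. \<bar>M i j\<bar> * (n i / 2))"
      proof (intro sum.cong[OF refl], subst eq, rule sum.cong[OF refl])
        fix i j
        show "(if j = i then 0 else \<bar>M j i\<bar> * (n i / 2)) = (if i = j then 0 else \<bar>M i j\<bar> * (n i / 2))"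
          using sym[of i j] by simp
      qed
      finally have swap: "(\<Sum>i<N. \<Sum>j\<in>{..<N} - {i}. \<bar>M i j\<bar> * (n j / 2))
          = (\<Sum>i<N. \<Sum>j\<in>{..<N} - {i}. \<bar>M i j\<bar> * (n i / 2))" .
      have half: "(\<Sum>i<N. \<Sum>j\<in>{..<N} - {i}. \<bar>M i j\<bar> * (n i / 2)) = (\<Sum>i<N. R i * n i / 2)"
        by (simp add: R_def sum_distrib_right sum_divide_distrib)
      show ?thesis unfolding swap half sum.distrib[symmetric] field_sum_of_halves ..
    qed
    finally have O: "norm O' \<le> (\<Sum>i<N. R i * n i)" .
    have bes: "(\<Sum>i<N. n i) \<le> 1"
    proof -
      have "(norm v)\<^sup>2 \<le> 1" using v by (simp add: power_le_one)
      then show ?thesis using orthonormal_seq_bessel[OF e, of v] by (simp add: n_def x_def)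
    qed
    have "(\<Sum>i<N. R i * n i) \<le> D"
      unfolding D_def using low n0 by (intro sum_mono mult_right_mono) (auto simp: R_def)
    moreover have "(\<Sum>i<N. R i * n i) \<le> (\<Sum>i<N. (1 - M i i) * n i)"
      using up n0 by (intro sum_mono mult_right_mono) (auto simp: R_def)
    then have "(\<Sum>i<N. R i * n i) \<le> 1 - D"
      using bes by (simp add: D_def left_diff_distrib sum_subtractf)
    ultimately have O2: "norm O' \<le> D" "norm O' \<le> 1 - D" using O by linarith+
    have O_real: "O' = cnjg O'"
    proof -
      have "ip (?A v) v = cnjg (ip (?A v) v)" by (subst ip_cnjg) (simp add: sa)
      then have "of_real D + O' = of_real D + cnjg O'" unfolding split by (simp add: cnjg_add)
      then show ?thesis by simp
    qed
    obtain r where "O' = of_real r" by (rule cnjg_fixed_imp_real[OF O_real])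
    then have "ip (?A v) v = of_real (D + r)" "norm O' = \<bar>r\<bar>" using split by auto
    then show ?thesis using O2 by (intro bexI[of _ "D + r"]) auto
  qed
  then show ?thesis using bdd sa by (auto simp: pos_ball_def self_adjoint_def)
qed

end

section \<open>A diagonal matrix with a Jacobi tail\<close>

text \<open>On the indices below \<open>m\<close> the matrix is diagonal; from \<open>m\<close> on it is a free Jacobi matrix, whose
  diagonal \<open>1/2\<close> and off-diagonal \<open>1/4\<close> make the spectrum become dense in \<open>[0, 1]\<close> as the length
  grows, without leaving that interval.
  The missing neighbour of the index \<open>m\<close> leaves room there for the couplings \<open>a\<close>.\<close>

definition tail_matrix :: "nat \<Rightarrow> real \<Rightarrow> (nat \<Rightarrow> real) \<Rightarrow> nat \<Rightarrow> nat \<Rightarrow> real" where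
  "tail_matrix m a \<mu> i j =
     (if i = j then if i < m then \<mu> i else 1/2
      else if i < m \<and> j = m \<or> j < m \<and> i = m then a
      else if m \<le> i \<and> m \<le> j \<and> (i = Suc j \<or> j = Suc i) then 1/4 else 0)"

lemma tail_matrix_sym: "tail_matrix m a \<mu> i j = tail_matrix m a \<mu> j i"
  by (auto simp: tail_matrix_def)

lemma tail_matrix_row_sum:
  assumes a: "a > 0" "a * real m \<le> 1/4" and "i < N"
  shows "(\<Sum>j\<in>{..<N} - {i}. \<bar>tail_matrix m a \<mu> i j\<bar>) \<le> (if i < m then a else 1/2)"
proof -
  consider "i < m" | "i = m" | "i > m" by linarith
  then show ?thesis
  proof cases
    case 1
    have "(\<Sum>j\<in>{..<N} - {i}. \<bar>tail_matrix m a \<mu> i j\<bar>) \<le> (\<Sum>j\<in>{..<N} - {i}. if j = m then a else 0)"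
      using 1 a by (intro sum_mono) (auto simp: tail_matrix_def)
    also have "\<dots> \<le> a" using a by (simp add: sum.delta)
    finally show ?thesis using 1 by simp
  next
    case 2
    have "(\<Sum>j\<in>{..<N} - {i}. \<bar>tail_matrix m a \<mu> i j\<bar>)
        \<le> (\<Sum>j\<in>{..<N} - {i}. (if j < m then a else 0) + (if j = Suc m then 1/4 else 0))"
      using 2 a by (intro sum_mono) (auto simp: tail_matrix_def)
    also have "\<dots> = (\<Sum>j\<in>{..<N} - {i}. if j < m then a else 0)
        + (\<Sum>j\<in>{..<N} - {i}. if j = Suc m then 1/4 else 0)"
      by (rule sum.distrib)
    also have "(\<Sum>j\<in>{..<N} - {i}. if j < m then a else 0) = a * real m"
    proof -
      have "({..<N} - {i}) \<inter> {j. j < m} = {..<m}" using 2 assms(3) by auto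
      then show ?thesis by (simp add: sum.If_cases)
    qed
    also have "(\<Sum>j\<in>{..<N} - {i}. if j = Suc m then 1/4 else 0) \<le> (1/4 :: real)" by (simp add: sum.delta)
    finally show ?thesis using 2 a by simp
  next
    case 3
    have "(\<Sum>j\<in>{..<N} - {i}. \<bar>tail_matrix m a \<mu> i j\<bar>)
        \<le> (\<Sum>j\<in>{..<N} - {i}. (if j = i - 1 then 1/4 else 0) + (if j = Suc i then 1/4 else 0))"
      using 3 a by (intro sum_mono) (auto simp: tail_matrix_def)
    also have "\<dots> \<le> 1/4 + 1/4"
      unfolding sum.distrib by (intro add_mono) (auto simp: sum.delta)
    finally show ?thesis using 3 by simp
  qed
qed

text \<open>The bound \<open>a m \<le> 1/4\<close> keeps row \<open>m\<close> diagonally dominant, and the distance \<open>a\<close> of the \<open>\<mu>\<^sub>i\<close>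
  from \<open>0\<close> and \<open>1\<close> does the same for the rows below \<open>m\<close>. The vectors \<open>e\<^sub>i\<close> with \<open>i < m\<close> are called the
  head, the others the tail.\<close>

locale jacobi_tail = hilbert_space scale ip
  for scale :: "'k::real_or_complex \<Rightarrow> 'h::banach \<Rightarrow> 'h" and ip +
  fixes e :: "nat \<Rightarrow> 'h" and m N :: nat and a :: real and \<mu> :: "nat \<Rightarrow> real"
  assumes on: "orthonormal_seq e N" and mN: "m + 2 \<le> N"
    and a: "a > 0" "a * real m \<le> 1/4"
    and \<mu>: "\<And>i. i < m \<Longrightarrow> a \<le> \<mu> i" "\<And>i. i < m \<Longrightarrow> \<mu> i \<le> 1 - a"
    and inj: "inj_on \<mu> {..<m}"
begin

abbreviation "G \<equiv> e ` {..<m}"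

definition op where "op = mat_op e N (tail_matrix m a \<mu>)"

lemma op_pos_ball: "op \<in> pos_ball"
  unfolding op_def
proof (rule mat_op_pos_ball[OF on tail_matrix_sym])
  fix i assume i: "i < N"
  note row = tail_matrix_row_sum[OF a i, of \<mu>]
  have d: "tail_matrix m a \<mu> i i = (if i < m then \<mu> i else 1/2)" by (simp add: tail_matrix_def)
  show "(\<Sum>j\<in>{..<N} - {i}. \<bar>tail_matrix m a \<mu> i j\<bar>) \<le> tail_matrix m a \<mu> i i"
    unfolding d by (rule order_trans[OF row]) (use \<mu> in auto)
  show "(\<Sum>j\<in>{..<N} - {i}. \<bar>tail_matrix m a \<mu> i j\<bar>) \<le> 1 - tail_matrix m a \<mu> i i"
    unfolding d by (rule order_trans[OF row]) (use \<mu> in force)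
qed

lemma op_diag:
  assumes i: "i < m"
  shows "blinfun_apply op (e i) = \<mu> i *\<^sub>R e i + a *\<^sub>R e m"
proof -
  have "blinfun_apply op (e i) = (\<Sum>j<N. tail_matrix m a \<mu> j i *\<^sub>R e j)"
    unfolding op_def using mat_op_basis[OF on] i mN by simp
  also have "\<dots> = (\<Sum>j<N. (if j = i then \<mu> i *\<^sub>R e i else 0) + (if j = m then a *\<^sub>R e m else 0))"
    using i by (intro sum.cong) (auto simp: tail_matrix_def)
  also have "\<dots> = \<mu> i *\<^sub>R e i + a *\<^sub>R e m"
    unfolding sum.distrib using i mN by simp
  finally show ?thesis .
qed

lemma op_junction:
  "blinfun_apply op (e m) = (1/2) *\<^sub>R e m + (1/4) *\<^sub>R e (Suc m) + a *\<^sub>R (\<Sum>i<m. e i)"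
proof -
  have "blinfun_apply op (e m) = (\<Sum>j<N. tail_matrix m a \<mu> j m *\<^sub>R e j)"
    unfolding op_def using mat_op_basis[OF on] mN by simp
  also have "\<dots> = (\<Sum>j<N. ((if j = m then (1/2) *\<^sub>R e m else 0) + (if j = Suc m then (1/4) *\<^sub>R e (Suc m) else 0))
      + (if j < m then a *\<^sub>R e j else 0))"
    by (intro sum.cong) (auto simp: tail_matrix_def)
  also have "\<dots> = (1/2) *\<^sub>R e m + (1/4) *\<^sub>R e (Suc m) + (\<Sum>j<N. if j < m then a *\<^sub>R e j else 0)"
    unfolding sum.distrib using mN by simp
  also have "(\<Sum>j<N. if j < m then a *\<^sub>R e j else 0) = a *\<^sub>R (\<Sum>i<m. e i)"
  proof -
    have "{..<N} \<inter> {j. j < m} = {..<m}" using mN by auto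
    then show ?thesis by (simp add: sum.If_cases scaleR_sum_right)
  qed
  finally show ?thesis .
qed

lemma op_tail:
  assumes k: "m + k + 2 < N"
  shows "blinfun_apply op (e (m + k + 1))
    = (1/2) *\<^sub>R e (m + k + 1) + (1/4) *\<^sub>R e (m + k) + (1/4) *\<^sub>R e (m + k + 2)"
proof -
  have "blinfun_apply op (e (m + k + 1)) = (\<Sum>j<N. tail_matrix m a \<mu> j (m + k + 1) *\<^sub>R e j)"
    unfolding op_def using mat_op_basis[OF on] k by simp
  also have "\<dots> = (\<Sum>j<N. ((if j = m + k + 1 then (1/2) *\<^sub>R e (m + k + 1) else 0)
      + (if j = m + k then (1/4) *\<^sub>R e (m + k) else 0)) + (if j = m + k + 2 then (1/4) *\<^sub>R e (m + k + 2) else 0))"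
    by (intro sum.cong) (auto simp: tail_matrix_def)
  also have "\<dots> = (1/2) *\<^sub>R e (m + k + 1) + (1/4) *\<^sub>R e (m + k) + (1/4) *\<^sub>R e (m + k + 2)"
    unfolding sum.distrib using k by simp
  finally show ?thesis .
qed

lemma op_range: "blinfun_apply op x \<in> span (e ` {..<N})"
  unfolding op_def mat_op_apply by (intro span_sum span_scale span_base) auto

text \<open>Let \<open>r\<close> be the eigenvalue. Tail coordinates satisfy the three-term recurrence with
  \<open>c = 4 r - 2 \<in> [-2, 2]\<close>, so the first two are at most \<open>\<sigma>\<close>. The equation at \<open>m\<close> then bounds the sum
  of the head coordinates \<open>x\<^sub>j\<close>, and the equation \<open>(r - \<mu>\<^sub>j) x\<^sub>j = a z\<^sub>0\<close> bounds each \<open>x\<^sub>j\<close> for which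
  \<open>\<mu>\<^sub>j\<close> is not within \<open>\<kappa> / 2\<close> of \<open>r\<close>. At most one index is exceptional, and its coordinate is
  the sum minus all the others.\<close>

lemma eigenvector_components_small:
  assumes y: "norm y = 1" "blinfun_apply op y = r *\<^sub>R y" and r: "0 \<le> r" "r \<le> 1"
    and \<sigma>: "\<sigma> > 0" "10 \<le> real n * \<sigma>\<^sup>2" and n: "m + 2 * n + 2 \<le> N"
    and \<kappa>: "\<kappa> > 0" "\<And>i j. i < m \<Longrightarrow> j < m \<Longrightarrow> i \<noteq> j \<Longrightarrow> \<kappa> \<le> \<bar>\<mu> i - \<mu> j\<bar>"
    and i: "i < m"
  shows "norm (ip y (e i)) \<le> (1 / a + 2 * real m / \<kappa>) * \<sigma>"
proof -
  have coord: "of_real r * ip y (e k) = ip y (blinfun_apply op (e k))" for k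
    using pos_ballD(2)[OF op_pos_ball, of y "e k"] unfolding y(2) by (simp add: ip_scaleR_left)
  define x where "x i = ip y (e i)" for i
  define z where "z k = ip y (e (m + k))" for k
  have "real n > 0" using \<sigma> by (cases n) auto
  have z_small: "norm (z k) \<le> \<sigma>" if k: "k \<le> 1" for k
  proof -
    have "real n * (norm (z k))\<^sup>2 \<le> 10"
    proof (rule three_term_value_bound[where c = "4 * r - 2" and N = "2 * n + 1" and z = z and i = k])
      show "\<bar>4 * r - 2\<bar> \<le> 2" using r by auto
      fix l assume l: "l + 2 \<le> 2 * n + 1"
      have "of_real r * z (l + 1) = of_real (1/2) * z (l + 1) + of_real (1/4) * z l + of_real (1/4) * z (l + 2)"
        using coord[of "m + l + 1"] op_tail[of l] l n
        by (simp add: z_def ip_add_right ip_scaleR_right add.assoc)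
      then have "of_real 4 * (of_real r * z (l + 1))
          = of_real 4 * (of_real (1/2) * z (l + 1) + of_real (1/4) * z l + of_real (1/4) * z (l + 2))"
        by simp
      then have "4 * of_real r * z (l + 1) = 2 * z (l + 1) + z l + z (l + 2)"
        by (simp add: distrib_left mult.assoc[symmetric] of_real_divide)
      then show "z (l + 2) = of_real (4 * r - 2) * z (l + 1) - z l"
        by (simp add: algebra_simps)
    next
      have "(\<Sum>k\<le>2 * n + 1. (norm (z k))\<^sup>2) = (\<Sum>j\<in>(\<lambda>k. m + k) ` {..2 * n + 1}. (norm (ip y (e j)))\<^sup>2)"
        unfolding z_def by (subst sum.reindex) auto
      also have "\<dots> \<le> (\<Sum>j<N. (norm (ip y (e j)))\<^sup>2)"
        using n by (intro sum_mono2) auto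
      also have "\<dots> \<le> 1" using orthonormal_seq_bessel[OF on, of y] y(1) by simp
      finally show "(\<Sum>k\<le>2 * n + 1. (norm (z k))\<^sup>2) \<le> 1" .
    qed (use k in auto)
    then have "real n * (norm (z k))\<^sup>2 \<le> real n * \<sigma>\<^sup>2" using \<sigma>(2) by linarith
    then have "(norm (z k))\<^sup>2 \<le> \<sigma>\<^sup>2" using \<open>real n > 0\<close> by simp
    then show ?thesis using \<sigma>(1) by (simp add: power2_le_iff_abs_le)
  qed
  have total: "norm (\<Sum>j<m. x j) \<le> \<sigma> / a"
  proof -
    have "of_real r * z 0 = of_real (1/2) * z 0 + of_real (1/4) * z 1 + of_real a * (\<Sum>j<m. x j)"
      using coord[of m] unfolding op_junction
      by (simp add: z_def x_def ip_add_right ip_scaleR_right ip_sum_right)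
    then have "of_real a * (\<Sum>j<m. x j) = of_real (r - 1/2) * z 0 - of_real (1/4) * z 1"
      unfolding of_real_diff left_diff_distrib by (simp add: algebra_simps)
    then have "norm (of_real a * (\<Sum>j<m. x j)) \<le> norm (of_real (r - 1/2) * z 0) + norm (of_real (1/4) * z 1)"
      by (metis norm_triangle_ineq4)
    also have "\<dots> \<le> (1/2) * \<sigma> + (1/4) * \<sigma>"
    proof -
      have "\<bar>r - 1/2\<bar> \<le> 1/2" unfolding abs_le_iff using r by linarith
      then have "\<bar>r - 1/2\<bar> * norm (z 0) \<le> (1/2) * \<sigma>" by (rule mult_mono) (use z_small[of 0] in auto)
      moreover have "\<bar>1/4\<bar> * norm (z 1) \<le> (1/4) * \<sigma>" using z_small[of 1] by simp
      ultimately show ?thesis unfolding norm_mult norm_of_real by (rule add_mono)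
    qed
    also have "\<dots> \<le> \<sigma>" using \<sigma>(1) by simp
    finally have "norm (\<Sum>j<m. x j) * a \<le> \<sigma>" using a(1) by (simp add: norm_mult mult.commute)
    then show ?thesis using a(1) by (simp add: pos_le_divide_eq)
  qed
  have away: "norm (x j) \<le> 2 * \<sigma> / \<kappa>" if j: "j < m" "\<kappa> / 2 \<le> \<bar>r - \<mu> j\<bar>" for j
  proof -
    have "of_real r * x j = of_real (\<mu> j) * x j + of_real a * z 0"
      using coord[of j] unfolding op_diag[OF j(1)] by (simp add: z_def x_def ip_add_right ip_scaleR_right)
    then have "of_real (r - \<mu> j) * x j = of_real a * z 0"
      by (simp add: left_diff_distrib)
    then have "\<bar>r - \<mu> j\<bar> * norm (x j) = a * norm (z 0)"
      using norm_mult[of "of_real (r - \<mu> j)" "x j"] norm_mult[of "of_real a" "z 0"] a(1)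
      by (simp only: norm_of_real abs_of_pos)
    also have "\<dots> \<le> 1 * \<sigma>"
      using a \<mu>[OF j(1)] z_small[of 0] by (intro mult_mono) auto
    finally have "\<bar>r - \<mu> j\<bar> * norm (x j) \<le> \<sigma>" by simp
    moreover have "\<kappa> / 2 * norm (x j) \<le> \<bar>r - \<mu> j\<bar> * norm (x j)"
      using j(2) by (intro mult_right_mono) auto
    ultimately have "\<kappa> / 2 * norm (x j) \<le> \<sigma>" by linarith
    then show ?thesis using \<kappa>(1) by (simp add: field_simps)
  qed
  have pos: "0 \<le> 2 * \<sigma> / \<kappa>" "0 \<le> \<sigma> / a" using \<sigma> \<kappa> a by auto
  have "norm (x i) \<le> \<sigma> / a + real m * (2 * \<sigma> / \<kappa>)"
  proof (cases "\<kappa> / 2 \<le> \<bar>r - \<mu> i\<bar>")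
    case True
    have "1 * (2 * \<sigma> / \<kappa>) \<le> real m * (2 * \<sigma> / \<kappa>)" using i pos by (intro mult_right_mono) auto
    then show ?thesis using away[OF i True] pos by linarith
  next
    case False
    have "norm (x j) \<le> 2 * \<sigma> / \<kappa>" if "j \<in> {..<m} - {i}" for j
    proof (rule away)
      show "j < m" using that by simp
      then have "\<kappa> \<le> \<bar>\<mu> i - \<mu> j\<bar>" using \<kappa>(2)[of i j] i that by simp
      then show "\<kappa> / 2 \<le> \<bar>r - \<mu> j\<bar>" using False by linarith
    qed
    then have "norm (\<Sum>j\<in>{..<m} - {i}. x j) \<le> (\<Sum>j\<in>{..<m} - {i}. 2 * \<sigma> / \<kappa>)"
      by (intro sum_norm_le) auto
    also have "\<dots> \<le> real m * (2 * \<sigma> / \<kappa>)"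
      unfolding sum_constant using pos by (intro mult_right_mono) (auto intro: order_trans[OF card_Diff1_le])
    finally have 1: "norm (\<Sum>j\<in>{..<m} - {i}. x j) \<le> real m * (2 * \<sigma> / \<kappa>)" .
    have "x i = (\<Sum>j<m. x j) - (\<Sum>j\<in>{..<m} - {i}. x j)" using i by (subst sum.remove[of "{..<m}" i]) auto
    then show ?thesis using norm_triangle_ineq4[of "\<Sum>j<m. x j" "\<Sum>j\<in>{..<m} - {i}. x j"] 1 total by simp
  qed
  then show ?thesis by (simp add: x_def algebra_simps)
qed

text \<open>Let \<open>Z\<close> be the space on the right. If \<open>e\<^sub>m\<close> were not in \<open>Z\<close>, the orbit of \<open>v\<close> could never leave the head:
  the coefficient \<open>a \<Sum>\<^sub>i \<mu>\<^sub>i\<^sup>j x\<^sub>i\<close> of \<open>e\<^sub>m\<close> in \<open>A\<^sup>j\<^sup>+\<^sup>1 v\<close> would vanish for every \<open>j\<close>, where \<open>x\<^sub>i\<close> are the coordinates of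
  \<open>v\<close>, and then \<open>v = 0\<close> by Vandermonde. Once \<open>e\<^sub>m\<close> is in \<open>Z\<close>, the space \<open>Z\<close> is invariant, and
  solving the action on \<open>e\<^sub>m\<^sub>+\<^sub>k\<close> for its last term produces the vectors of the tail one after the other.\<close>

lemma krylov_with_head_spans:
  assumes v: "v \<in> span G" "v \<noteq> 0"
  shows "span (e ` {..<N}) \<subseteq> span (krylov op v \<union> G)"
proof -
  define Z where "Z = span (krylov op v \<union> G)"
  have sub: "subspace Z" by (simp add: Z_def)
  have "krylov op v \<union> G \<subseteq> Z" unfolding Z_def by (rule span_superset)
  then have KZ: "krylov op v \<subseteq> Z" and GZ: "G \<subseteq> Z" by simp_all
  have e_sub: "e i \<in> Z" if "i < m" for i using that GZ by auto
  have em: "e m \<in> Z"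
  proof (rule ccontr)
    assume not: "e m \<notin> Z"
    define x where "x i = ip v (e i)" for i
    have pow: "(blinfun_apply op ^^ j) v = (\<Sum>i<m. scale (of_real (\<mu> i ^ j) * x i) (e i))
        \<and> (\<Sum>i<m. of_real (\<mu> i ^ j) * x i) = 0" for j
    proof -
      have step: "(\<Sum>i<m. of_real (\<mu> i ^ j) * x i) = 0
          \<and> blinfun_apply op ((blinfun_apply op ^^ j) v) = (\<Sum>i<m. scale (of_real (\<mu> i ^ Suc j) * x i) (e i))"
        if eq: "(blinfun_apply op ^^ j) v = (\<Sum>i<m. scale (of_real (\<mu> i ^ j) * x i) (e i))" for j
      proof -
        define s where "s = (\<Sum>i<m. of_real (\<mu> i ^ j) * x i)"
        define h where "h = (\<Sum>i<m. scale (of_real (\<mu> i ^ Suc j) * x i) (e i))"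
        have split: "scale (s * of_real a) (e m) = (\<Sum>i<m. scale (of_real (\<mu> i ^ j) * x i * of_real a) (e m))"
          unfolding s_def sum_distrib_right scale_sum_left ..
        have "blinfun_apply op ((blinfun_apply op ^^ j) v)
            = (\<Sum>i<m. scale (of_real (\<mu> i ^ j) * x i) (\<mu> i *\<^sub>R e i + a *\<^sub>R e m))"
          unfolding eq blinfun.sum_right pos_ballD(1)[OF op_pos_ball] by (intro sum.cong) (auto simp: op_diag)
        also have "\<dots> = h + scale (s * of_real a) (e m)"
          unfolding split h_def scale_of_real[symmetric] sum.distrib[symmetric]
          by (intro sum.cong refl) (simp add: scale_right_distrib mult_ac)
        finally have A: "blinfun_apply op ((blinfun_apply op ^^ j) v) = h + scale (s * of_real a) (e m)" .
        have hZ: "h \<in> Z" unfolding h_def by (intro subspace_sum sub subspace_scale e_sub) simp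
        have "blinfun_apply op ((blinfun_apply op ^^ j) v) \<in> Z"
          using subsetD[OF KZ krylov_power[of "Suc j" op v]] by simp
        from subspace_diff[OF sub this hZ] have sZ: "scale (s * of_real a) (e m) \<in> Z"
          unfolding A by simp
        have s0: "s = 0"
        proof (rule ccontr)
          assume "s \<noteq> 0"
          then have "e m \<in> Z" using subspace_scale[OF sub sZ, of "inverse (s * of_real a)"] a(1)
            by (simp del: inverse_mult_distrib)
          then show False using not by simp
        qed
        then have "blinfun_apply op ((blinfun_apply op ^^ j) v) = h" using A by simp
        with s0 show ?thesis unfolding h_def s_def by (rule conjI)
      qed
      have "(blinfun_apply op ^^ j) v = (\<Sum>i<m. scale (of_real (\<mu> i ^ j) * x i) (e i))"
      proof (induction j)
        case 0
        show ?case using orthonormal_seq_expand[OF orthonormal_seq_le[OF on] v(1)] mN by (simp add: x_def)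
      next
        case (Suc j)
        then show ?case using step[of j] by simp
      qed
      then show ?thesis using step[of j] by blast
    qed
    have "x i = 0" if "i < m" for i
      using power_sums_zero_imp_zero[OF _ inj, of x i] pow that by blast
    then have "v = 0" using orthonormal_seq_expand[OF orthonormal_seq_le[OF on] v(1)] mN by (simp add: x_def)
    then show False using v(2) by simp
  qed
  have inv: "blinfun_apply op x \<in> Z" if "x \<in> Z" for x
    using that unfolding Z_def
  proof (induction rule: span_induct_alt)
    case (step c x y)
    have "blinfun_apply op x \<in> Z"
    proof (cases "x \<in> krylov op v")
      case True
      then show ?thesis using krylov_invariant[OF op_pos_ball] KZ by blast
    next
      case False
      then obtain i where i: "i < m" "x = e i" using step(1) by auto
      show ?thesis unfolding i(2) op_diag[OF i(1)]
        using e_sub[OF i(1)] em by (intro subspace_add subspace_scaleR sub)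
    qed
    then show ?case using step(2)
      by (simp add: blinfun.add_right pos_ballD(1)[OF op_pos_ball] Z_def span_add span_scale)
  qed (simp add: span_zero)
  have tail: "m + Suc k < N \<longrightarrow> e (m + k) \<in> Z \<and> e (m + Suc k) \<in> Z" for k
  proof (induction k)
    case 0
    have "e (Suc m) = 4 *\<^sub>R (blinfun_apply op (e m) - (1/2) *\<^sub>R e m - a *\<^sub>R (\<Sum>i<m. e i))"
      unfolding op_junction by simp
    also have "\<dots> \<in> Z"
      using em inv e_sub by (intro subspace_scaleR subspace_diff subspace_sum sub) auto
    finally show ?case using em by simp
  next
    case (Suc k)
    show ?case
    proof
      assume k: "m + Suc (Suc k) < N"
      then have IH: "e (m + k) \<in> Z" "e (m + k + 1) \<in> Z" using Suc by auto
      have "e (m + k + 2) = 4 *\<^sub>R (blinfun_apply op (e (m + k + 1)) - (1/2) *\<^sub>R e (m + k + 1) - (1/4) *\<^sub>R e (m + k))"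
        using k by (subst op_tail) auto
      also have "\<dots> \<in> Z"
        using IH inv by (intro subspace_scaleR subspace_diff sub) auto
      finally show "e (m + Suc k) \<in> Z \<and> e (m + Suc (Suc k)) \<in> Z" using IH by simp
    qed
  qed
  have "e i \<in> Z" if i: "i < N" for i
  proof (cases "i \<le> m")
    case True
    then show ?thesis using e_sub em by (cases "i = m") auto
  next
    case False
    then obtain k where "i = m + Suc k" using less_imp_Suc_add not_le by (metis add_Suc_right)
    then show ?thesis using tail[of k] i by auto
  qed
  then have "e ` {..<N} \<subseteq> Z" by auto
  then show ?thesis using span_minimal[OF _ sub] unfolding Z_def by blast
qed

text \<open>The difference of \<open>w\<close> and its projection to the orbit span \<open>K\<close> lies in the orthogonal
  complement \<open>W\<close> of \<open>K\<close>, and it is expanded in an eigenbasis \<open>Y\<close> of \<open>W\<close>. Each coefficient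
  is an inner product of \<open>w\<close> with an eigenvector, hence small; \<open>Y\<close> has at most \<open>m\<close> elements because
  projecting the head to \<open>W\<close> already yields all of \<open>W\<close>.\<close>

lemma head_in_krylov_approx:
  assumes small: "\<And>y r i. norm y = 1 \<Longrightarrow> blinfun_apply op y = r *\<^sub>R y \<Longrightarrow> 0 \<le> r \<Longrightarrow> r \<le> 1 \<Longrightarrow>
      i < m \<Longrightarrow> norm (ip y (e i)) \<le> c"
    and c: "c \<ge> 0" and v: "v \<in> span G" "v \<noteq> 0" and w: "w \<in> span G"
  shows "\<exists>k \<in> krylov op v. norm (k - w) \<le> real m * (real m * norm w * c)"
proof -
  let ?K = "krylov op v" and ?X = "span (e ` {..<N})"
  have GX: "span G \<subseteq> ?X" using mN by (intro span_mono) auto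
  have KX: "?K \<subseteq> ?X"
    using v(1) GX op_range by (intro krylov_least[OF op_pos_ball]) auto
  obtain Q where Q: "finite Q" "orthonormal Q" "span Q = ?K"
    using subspace_orthonormal_basis[OF _ subspace_krylov KX] by blast
  define W where "W = {x \<in> ?X. \<forall>k\<in>?K. ip x k = 0}"
  have subW: "subspace W" unfolding W_def subspace_def
    by (auto simp: ip_add_left ip_scale_left span_add span_scale span_zero)
  have WX: "W \<subseteq> ?X" unfolding W_def by (rule Collect_restrict)
  obtain B where B: "finite B" "span B = W"
    using subspace_orthonormal_basis[OF finite_imageI[OF finite_lessThan] subW WX] by blast
  obtain Y where Y: "finite Y" "orthonormal Y" "span Y = W"
    and eig: "\<And>y. y \<in> Y \<Longrightarrow> \<exists>r. blinfun_apply op y = r *\<^sub>R y"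
  proof (rule symmetric_eigenbasis[of B W "blinfun_apply op"])
    show "linear_map_on W (blinfun_apply op)"
      using op_pos_ball by (intro linear_map_on_op) (simp add: pos_ball_def)
    show "blinfun_apply op x \<in> W" if x: "x \<in> W" for x
    proof -
      have "ip (blinfun_apply op x) k = 0" if "k \<in> ?K" for k
        unfolding pos_ballD(2)[OF op_pos_ball]
        using x krylov_invariant[OF op_pos_ball that] unfolding W_def by blast
      then show ?thesis unfolding W_def using op_range[of x] by blast
    qed
    show "ip (blinfun_apply op x) y = ip x (blinfun_apply op y)" for x y
      by (rule pos_ballD(2)[OF op_pos_ball])
  qed (use B in auto)
  have YW: "Y \<subseteq> W" using span_superset[of Y] unfolding Y(3) .
  define p where "p x = x - proj Q x" for x
  have p_span: "p g \<in> span (p ` G)" if "g \<in> span G" for g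
    using that
  proof (induction rule: span_induct_alt)
    case base
    show ?case by (simp add: p_def proj_def span_zero)
  next
    case (step c x y)
    have "p (scale c x + y) = scale c (p x) + p y"
      by (simp add: p_def proj_add proj_scale scale_right_diff_distrib)
    then show ?case using step by (auto intro!: span_add span_scale intro: span_base)
  qed
  have "Y \<subseteq> span (p ` G)"
  proof
    fix y assume "y \<in> Y"
    then have y: "y \<in> ?X" "\<And>k. k \<in> ?K \<Longrightarrow> ip y k = 0" using YW unfolding W_def by blast+
    obtain k g where kg: "y = k + g" "k \<in> ?K" "g \<in> span G"
      using subsetD[OF krylov_with_head_spans[OF v] y(1)]
      unfolding span_Un span_eq_iff[THEN iffD2, OF subspace_krylov] by blast
    have "proj Q y = 0"
      unfolding proj_def using y(2) span_base[of _ Q] unfolding Q(3) by (intro sum.neutral) auto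
    then have "y = p y" by (simp add: p_def)
    also have "\<dots> = p g"
      unfolding kg(1) using proj_id[OF Q(1,2)] kg(2) Q(3) by (simp add: p_def proj_add)
    finally show "y \<in> span (p ` G)" using p_span[OF kg(3)] by simp
  qed
  then have "card Y \<le> card (p ` G)"
    using independent_span_bound[OF _ orthonormal_independent[OF Y(2)], of "p ` G"] by blast
  also have "\<dots> \<le> m" 
    using card_image_le[of G p] card_image_le[of "{..<m}" e] by simp
  finally have cardY: "card Y \<le> m" .
  have proj_K: "proj Q w \<in> ?K" using proj_in_span[of Q w] Q(3) by simp
  have "p w \<in> W"
  proof -
    have "p w \<in> ?X" using w GX proj_K KX unfolding p_def by (intro span_diff) auto
    moreover have "ip (p w) k = 0" if "k \<in> ?K" for k
      using ip_proj[OF Q(1,2), of k w] that Q(3) by (simp add: p_def ip_diff_left)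
    ultimately show ?thesis by (simp add: W_def)
  qed
  then have "p w = (\<Sum>y\<in>Y. scale (ip (p w) y) y)"
    using orthonormal_expand[OF Y(1,2)] Y(3) by blast
  also have "norm \<dots> \<le> (\<Sum>y\<in>Y. real m * norm w * c)"
  proof (rule sum_norm_le)
    fix y assume yY: "y \<in> Y"
    then have ny: "norm y = 1" using orthonormal_norm[OF Y(2)] by simp
    obtain r where r: "blinfun_apply op y = r *\<^sub>R y" using eig yY by blast
    obtain s where s: "0 \<le> s" "s \<le> (norm y)\<^sup>2" "ip (blinfun_apply op y) y = of_real s"
      using pos_ball_form[OF op_pos_ball] by blast
    have "(of_real r :: 'k) = of_real s" using s(3) ny unfolding r by (simp add: ip_scaleR_left ip_self)
    then have "r = s" by (simp only: of_real_eq_iff)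
    then have le: "norm (ip y (e i)) \<le> c" if "i < m" for i
      using small[OF ny r _ _ that] s ny by simp
    have "ip y (proj Q w) = 0" using yY YW proj_K unfolding W_def by blast
    then have "ip (proj Q w) y = 0" using ip_eq_0_commute by blast
    then have "ip (p w) y = ip w y" by (simp add: p_def ip_diff_left)
    also have "\<dots> = (\<Sum>i<m. ip w (e i) * ip (e i) y)"
      by (subst orthonormal_seq_expand[OF orthonormal_seq_le[OF on] w]) (use mN in \<open>simp_all add: ip_sum_left ip_scale_left\<close>)
    also have "norm \<dots> \<le> (\<Sum>i<m. norm w * c)"
    proof (rule sum_norm_le)
      fix i assume "i \<in> {..<m}"
      then have i: "i < m" by simp
      have "norm (ip (e i) y) \<le> c" using le[OF i] by (subst ip_cnjg) simp
      moreover have "norm (ip w (e i)) \<le> norm w"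
        using orthonormal_seq_norm[OF on] i mN by (intro norm_ip_le) auto
      ultimately show "norm (ip w (e i) * ip (e i) y) \<le> norm w * c"
        unfolding norm_mult by (intro mult_mono) auto
    qed
    finally show "norm (scale (ip (p w) y) y) \<le> real m * norm w * c"
      using ny by (simp add: norm_scale)
  qed
  also have "\<dots> \<le> real m * (real m * norm w * c)"
    unfolding sum_constant using cardY c by (intro mult_right_mono) auto
  finally have "norm (proj Q w - w) \<le> real m * (real m * norm w * c)"
    by (simp add: p_def norm_minus_commute)
  then show ?thesis using proj_K by blast
qed

end

section \<open>Density\<close>

text \<open>Every admissible range for an eigenvalue is a nondegenerate interval, so distinct choices exist
  and their finitely many differences stay above some \<open>\<kappa> > 0\<close>. The bound \<open>1/4\<close> on \<open>d\<close> keeps the intervals nondegenerate.\<close>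

lemma separated_eigenvalues:
  fixes \<nu> :: "nat \<Rightarrow> real"
  assumes \<nu>: "\<And>i. i < m \<Longrightarrow> 0 \<le> \<nu> i \<and> \<nu> i \<le> 1" and d: "0 < d" "d \<le> 1/4"
  obtains \<mu> \<kappa> where "\<And>i. i < m \<Longrightarrow> d \<le> \<mu> i \<and> \<mu> i \<le> 1 - d \<and> \<bar>\<mu> i - \<nu> i\<bar> \<le> 2 * d"
    "inj_on \<mu> {..<m}" "\<kappa> > 0" "\<And>i j. i < m \<Longrightarrow> j < m \<Longrightarrow> i \<noteq> j \<Longrightarrow> \<kappa> \<le> \<bar>\<mu> i - \<mu> j\<bar>"
proof -
  define S where "S i = {max d (\<nu> i - 2 * d)..min (1 - d) (\<nu> i + 2 * d)}" for i
  have "infinite (S i)" if "i \<in> {..<m}" for i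
    unfolding S_def using \<nu>[of i] d that by (intro infinite_Icc) auto
  then obtain \<mu> where \<mu>: "inj_on \<mu> {..<m}" "\<And>i. i \<in> {..<m} \<Longrightarrow> \<mu> i \<in> S i"
    using injective_choice_from_infinite_sets[of "{..<m}" S] by auto
  define P where "P = (\<lambda>(i, j). \<bar>\<mu> i - \<mu> j\<bar>) ` {(i, j). i < m \<and> j < m \<and> i \<noteq> j}"
  have "finite {(i, j). i < m \<and> j < m \<and> i \<noteq> j}"
    by (rule finite_subset[of _ "{..<m} \<times> {..<m}"]) auto
  then have fin: "finite P" unfolding P_def by simp
  have "\<forall>p\<in>P. p > 0" using \<mu>(1) by (auto simp: P_def inj_on_def)
  then have "Min (insert 1 P) > 0" using fin by simp
  moreover have "Min (insert 1 P) \<le> \<bar>\<mu> i - \<mu> j\<bar>" if "i < m" "j < m" "i \<noteq> j" for i j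
    using fin that by (intro Min_le) (auto simp: P_def)
  moreover have "d \<le> \<mu> i \<and> \<mu> i \<le> 1 - d \<and> \<bar>\<mu> i - \<nu> i\<bar> \<le> 2 * d" if "i < m" for i
    using \<mu>(2)[of i] that by (auto simp: S_def abs_le_iff)
  ultimately show ?thesis using that[of \<mu> "Min (insert 1 P)"] \<mu>(1) by blast
qed

context hilbert_space
begin

text \<open>\<open>T\<close> is the operator \<open>A\<close> followed by the projection to \<open>span B\<close>. It agrees with \<open>A\<close> wherever \<open>A\<close> does
  not leave \<open>span B\<close>, and it has the same quadratic form there, which places its eigenvalues
  in \<open>[0, 1]\<close>.\<close>

lemma compression_eigenbasis:
  assumes A: "A \<in> pos_ball" and B: "finite B"
  obtains e m \<nu> T where "orthonormal_seq e m" "span (e ` {..<m}) = span B"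
    "\<And>i. i < m \<Longrightarrow> 0 \<le> \<nu> i \<and> \<nu> i \<le> 1" "\<And>i. i < m \<Longrightarrow> T (e i) = \<nu> i *\<^sub>R e i"
    "linear_map_on (span B) T" "\<And>x. blinfun_apply A x \<in> span B \<Longrightarrow> T x = blinfun_apply A x"
proof -
  obtain G where G: "finite G" "orthonormal G" "span G = span B" using orthonormal_exists[OF B] by blast
  define T where "T x = proj G (blinfun_apply A x)" for x
  have lin: "linear_map_on (span B) T"
    by (simp add: linear_map_on_def T_def blinfun.add_right pos_ballD(1)[OF A] proj_add proj_scale)
  have TA: "ip (T x) y = ip (blinfun_apply A x) y" if "y \<in> span B" for x y
    unfolding T_def by (rule ip_proj[OF G(1,2)]) (simp add: G(3) that)
  obtain Y where Y: "finite Y" "orthonormal Y" "span Y = span B"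
    and eig: "\<And>y. y \<in> Y \<Longrightarrow> \<exists>r. T y = r *\<^sub>R y"
  proof (rule symmetric_eigenbasis[OF B refl lin])
    show "T x \<in> span B" for x unfolding T_def G(3)[symmetric] by (rule proj_in_span)
    show "ip (T x) y = ip x (T y)" if "x \<in> span B" "y \<in> span B" for x y
      using TA[OF that(2), of x] TA[OF that(1), of y] pos_ballD(2)[OF A, of x y]
        ip_cnjg[where y = x and x = "T y"] ip_cnjg[where y = x and x = "blinfun_apply A y"]
      by simp
  qed blast
  obtain e where e: "bij_betw e {..<card Y} Y"
    using ex_bij_betw_nat_finite[OF Y(1)] by (auto simp: lessThan_atLeast0)
  have eY: "e i \<in> Y" if "i < card Y" for i using e that by (auto simp: bij_betw_def)
  have "orthonormal_seq e (card Y)"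
    unfolding orthonormal_seq_def
  proof (intro allI impI)
    fix i j assume ij: "i < card Y" "j < card Y"
    then have "e i = e j \<longleftrightarrow> i = j" using e by (auto simp: bij_betw_def inj_on_def)
    then show "ip (e i) (e j) = (if i = j then 1 else 0)"
      using orthonormalD[OF Y(2) eY[OF ij(1)] eY[OF ij(2)]] by simp
  qed
  moreover have "span (e ` {..<card Y}) = span B" using e Y(3) by (simp add: bij_betw_def)
  moreover have "\<exists>l. 0 \<le> l \<and> l \<le> 1 \<and> T (e i) = l *\<^sub>R e i" if i: "i < card Y" for i
  proof -
    obtain r where r: "T (e i) = r *\<^sub>R e i" using eig eY[OF i] by blast
    have n: "norm (e i) = 1" using orthonormal_norm[OF Y(2) eY[OF i]] .
    have "e i \<in> span B" using span_base[OF eY[OF i]] Y(3) by simp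
    then have 1: "ip (blinfun_apply A (e i)) (e i) = of_real r"
      using TA[of "e i" "e i"] unfolding r by (simp add: ip_scaleR_left ip_self n)
    obtain s where s: "0 \<le> s" "s \<le> (norm (e i))\<^sup>2" "ip (blinfun_apply A (e i)) (e i) = of_real s"
      using pos_ball_form[OF A] by blast
    have "(of_real r :: 'k) = of_real s" using 1 s(3) by simp
    then have "r = s" by (simp only: of_real_eq_iff)
    then show ?thesis using r s n by auto
  qed
  then obtain l where "\<And>i. i < card Y \<Longrightarrow> 0 \<le> l i \<and> l i \<le> 1 \<and> T (e i) = l i *\<^sub>R e i" by metis
  moreover have "T x = blinfun_apply A x" if "blinfun_apply A x \<in> span B" for x
    unfolding T_def by (rule proj_id[OF G(1,2)]) (simp add: G(3) that)
  ultimately show ?thesis using that[of e "card Y" l T] lin by blast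
qed

text \<open>The parameters are fixed in this order: the size \<open>d\<close> of the perturbation, from the test vectors
  and \<open>\<epsilon>\<close>; the separated eigenvalues \<open>\<mu>\<close> with gap \<open>\<kappa>\<close> and the coupling \<open>a\<close>; the bound \<open>\<sigma>\<close> on the
  start of the tail, small compared with \<open>\<delta>\<close>; and only then the length of the tail, which
  affects none of the previous quantities.\<close>

lemma approx_cyclic_meets_nbhd:
  assumes inf: "\<not> finite_dim UNIV" and A: "A \<in> pos_ball"
    and I: "finite I" and F: "finite F" and \<epsilon>: "\<epsilon> > 0" and \<delta>: "\<delta> > 0"
  shows "nbhd A I \<epsilon> \<inter> approx_cyclic F w \<delta> \<noteq> {}"
proof -
  define B where "B = I \<union> blinfun_apply A ` I \<union> insert w F"
  have B: "finite B" using I F by (simp add: B_def)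
  obtain e0 m \<nu> T where e0: "orthonormal_seq e0 m" "span (e0 ` {..<m}) = span B"
    and \<nu>: "\<And>i. i < m \<Longrightarrow> 0 \<le> \<nu> i \<and> \<nu> i \<le> 1" and eig: "\<And>i. i < m \<Longrightarrow> T (e0 i) = \<nu> i *\<^sub>R e0 i"
    and lin: "linear_map_on (span B) T"
    and TA: "\<And>x. blinfun_apply A x \<in> span B \<Longrightarrow> T x = blinfun_apply A x"
    using compression_eigenbasis[OF A B] by blast
  define R where "R = 1 + (\<Sum>x\<in>I. norm x)"
  have R: "R \<ge> 1" unfolding R_def by (simp add: sum_nonneg)
  have norm_R: "norm x \<le> R" if "x \<in> I" for x
    using member_le_sum[of x I norm] that I by (simp add: R_def)
  define d where "d = min (1/4) (\<epsilon> / (4 * (real m + 1) * R))"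
  have d: "0 < d" "d \<le> 1/4" using \<epsilon> R unfolding d_def by (simp, intro min.cobounded1)
  have d\<epsilon>: "3 * d * real m * R < \<epsilon>"
  proof -
    have "4 * (real m + 1) * R > 0" using R by simp
    moreover have "d \<le> \<epsilon> / (4 * (real m + 1) * R)" unfolding d_def by (rule min.cobounded2)
    ultimately have "d * (4 * (real m + 1) * R) \<le> \<epsilon>" by (simp only: pos_le_divide_eq)
    moreover have "d * (4 * (real m + 1) * R) = 4 * (d * real m * R) + 4 * (d * R)"
      by (simp add: algebra_simps)
    moreover have "0 \<le> d * real m * R" "0 < d * R" using d R by auto
    moreover have "3 * d * real m * R = 3 * (d * real m * R)" by simp
    ultimately show ?thesis by linarith
  qed
  obtain \<mu> \<kappa> where \<mu>: "\<And>i. i < m \<Longrightarrow> d \<le> \<mu> i \<and> \<mu> i \<le> 1 - d \<and> \<bar>\<mu> i - \<nu> i\<bar> \<le> 2 * d"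
    and inj: "inj_on \<mu> {..<m}" and \<kappa>: "\<kappa> > 0" "\<And>i j. i < m \<Longrightarrow> j < m \<Longrightarrow> i \<noteq> j \<Longrightarrow> \<kappa> \<le> \<bar>\<mu> i - \<mu> j\<bar>"
    using separated_eigenvalues[of m \<nu> d] \<nu> d by blast
  define a where "a = d / (real m + 1)"
  have a: "0 < a" "a \<le> d" "a * real m \<le> 1/4"
  proof -
    show "0 < a" using d by (simp add: a_def)
    show "a \<le> d" using d by (simp add: a_def divide_le_eq)
    have "a * real m \<le> a * (real m + 1)" using \<open>0 < a\<close> by (intro mult_left_mono) auto
    also have "\<dots> = d" by (simp add: a_def)
    finally show "a * real m \<le> 1/4" using d by simp
  qed
  define C where "C = 1 / a + 2 * real m / \<kappa>"
  have C: "C \<ge> 0" using a \<kappa> by (simp add: C_def)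
  define Q where "Q = real m * (real m * norm w * C)"
  have Q: "Q \<ge> 0" using C by (simp add: Q_def)
  define \<sigma> where "\<sigma> = \<delta> / (Q + 1)"
  have \<sigma>: "\<sigma> > 0" using \<delta> Q by (simp add: \<sigma>_def)
  have Q\<sigma>: "Q * \<sigma> < \<delta>" using \<delta> Q by (simp add: \<sigma>_def pos_divide_less_eq algebra_simps)
  obtain n where "10 / \<sigma>\<^sup>2 < real n" using reals_Archimedean2 by blast
  then have n: "10 \<le> real n * \<sigma>\<^sup>2" using \<sigma> by (simp add: pos_divide_less_eq less_imp_le)
  define N where "N = m + 2 * n + 2"
  obtain e where e: "orthonormal_seq e N" and ee0: "\<And>i. i < m \<Longrightarrow> e i = e0 i"
    using orthonormal_seq_extend[OF inf e0(1), of N] by (auto simp: N_def)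
  interpret J: jacobi_tail scale ip e m N a \<mu>
  proof unfold_locales
    show "a \<le> \<mu> i" "\<mu> i \<le> 1 - a" if "i < m" for i using \<mu>[OF that] a by linarith+
  qed (use e a inj in \<open>auto simp: N_def\<close>)
  have "e ` {..<m} = e0 ` {..<m}" using ee0 by auto
  then have spB: "span (e ` {..<m}) = span B" using e0(2) by simp
  have small: "norm (ip y (e i)) \<le> C * \<sigma>"
    if "norm y = 1" "blinfun_apply J.op y = r *\<^sub>R y" "0 \<le> r" "r \<le> 1" "i < m" for y r i
    unfolding C_def
    using that \<sigma> n \<kappa> by (intro J.eigenvector_components_small[where n = n]) (auto simp: N_def)
  have "J.op \<in> approx_cyclic F w \<delta>"
    unfolding approx_cyclic_def
  proof (intro CollectI conjI ballI impI)
    show "J.op \<in> pos_ball" by (rule J.op_pos_ball)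
    fix v assume v: "v \<in> span F" "norm v = 1"
    have vB: "v \<in> span (e ` {..<m})" unfolding spB using v(1) span_mono[of F B] by (auto simp: B_def)
    have wB: "w \<in> span (e ` {..<m})" unfolding spB by (rule span_base) (simp add: B_def)
    have v0: "v \<noteq> 0" using v(2) by auto
    have "\<exists>k\<in>krylov J.op v. norm (k - w) \<le> real m * (real m * norm w * (C * \<sigma>))"
      by (rule J.head_in_krylov_approx[OF _ _ vB v0 wB]) (rule small, use C \<sigma> in auto)
    then obtain k where k: "k \<in> krylov J.op v" "norm (k - w) \<le> real m * (real m * norm w * (C * \<sigma>))"
      by blast
    then have "norm (k - w) \<le> Q * \<sigma>" by (simp add: Q_def mult.assoc)
    then show "\<exists>k\<in>krylov J.op v. norm (k - w) < \<delta>" using k(1) Q\<sigma> by force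
  qed
  \<comment> \<open>On the head, \<open>J.op\<close> differs from \<open>T\<close> by \<open>\<mu>\<^sub>i - \<nu>\<^sub>i\<close> on the diagonal and by the coupling.\<close>
  moreover have "J.op \<in> nbhd A I \<epsilon>"
    unfolding nbhd_def
  proof (intro CollectI conjI ballI)
    show "J.op \<in> pos_ball" by (rule J.op_pos_ball)
    fix x assume x: "x \<in> I"
    let ?G = "e ` {..<m}"
    have em: "orthonormal_seq e m" using orthonormal_seq_le[OF e] by (simp add: N_def)
    have xG: "x \<in> span ?G" unfolding spB using x by (intro span_base) (simp add: B_def)
    define s where "s = (\<Sum>g\<in>?G. norm (blinfun_apply J.op g - T g))"
    have Tx: "T x = blinfun_apply A x" using x by (intro TA span_base) (simp add: B_def)
    have bound: "norm (blinfun_apply J.op x - T x) \<le> s * norm x"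
      unfolding s_def
    proof (rule linear_map_on_bounded[OF _ orthonormal_seq_image[OF em] _ xG])
      have "linear_map_on (span ?G) (blinfun_apply J.op)"
        using J.op_pos_ball by (intro linear_map_on_op) (simp add: pos_ball_def)
      then show "linear_map_on (span ?G) (\<lambda>x. blinfun_apply J.op x - T x)"
        using lin unfolding spB by (rule linear_map_on_diff)
    qed simp
    have "s \<le> 3 * d * real m"
    proof -
      have "s = (\<Sum>i<m. norm (blinfun_apply J.op (e i) - T (e i)))"
        unfolding s_def using orthonormal_seq_inj[OF em] by (simp add: sum.reindex)
      also have "\<dots> \<le> (\<Sum>i<m. 3 * d)"
      proof (rule sum_mono)
        fix i assume "i \<in> {..<m}"
        then have i: "i < m" by simp
        have "blinfun_apply J.op (e i) - T (e i) = (\<mu> i - \<nu> i) *\<^sub>R e i + a *\<^sub>R e m"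
          using eig[OF i] ee0[OF i] J.op_diag[OF i] by (simp add: scaleR_left_diff_distrib)
        also have "norm \<dots> \<le> \<bar>\<mu> i - \<nu> i\<bar> * norm (e i) + \<bar>a\<bar> * norm (e m)"
          by (rule order_trans[OF norm_triangle_ineq]) simp
        also have "\<dots> \<le> 3 * d"
          using orthonormal_seq_norm[OF e, of i] orthonormal_seq_norm[OF e, of m] \<mu>[OF i] a i
          by (simp add: N_def)
        finally show "norm (blinfun_apply J.op (e i) - T (e i)) \<le> 3 * d" .
      qed
      finally show ?thesis by (simp add: mult.commute)
    qed
    then have "s * norm x \<le> 3 * d * real m * R"
      by (rule mult_mono) (use norm_R[OF x] d in auto)
    then have "norm (blinfun_apply J.op x - blinfun_apply A x) \<le> 3 * d * real m * R"
      using bound unfolding Tx by linarith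
    then show "norm (blinfun_apply J.op x - blinfun_apply A x) < \<epsilon>" using d\<epsilon> by linarith
  qed
  ultimately show ?thesis by blast
qed

lemma approx_cyclic_dense:
  assumes "\<not> finite_dim UNIV" "finite F" "\<delta> > 0"
  shows "pos_ball_sot closure_of approx_cyclic F w \<delta> = topspace pos_ball_sot"
  unfolding dense_intersects_open
proof (intro allI impI)
  fix U assume U: "openin pos_ball_sot U \<and> U \<noteq> {}"
  then obtain A where A: "A \<in> U" by blast
  then have Ap: "A \<in> pos_ball" using U openin_subset topspace_pos_ball_sot by blast
  obtain I \<epsilon> where "finite I" "\<epsilon> > 0" "nbhd A I \<epsilon> \<subseteq> U" using nbhd_subset_openin U A by blast
  then show "approx_cyclic F w \<delta> \<inter> U \<noteq> {}"
    using approx_cyclic_meets_nbhd[OF assms(1) Ap, of I F \<epsilon> \<delta> w] assms by blast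
qed

theorem comeager_cyclic:
  fixes D S :: "'h set"
  assumes inf: "\<not> finite_dim UNIV" and D: "countable D" "closure D = UNIV" and S: "countable S"
  shows "comeager_in pos_ball_sot
    {A \<in> pos_ball. \<forall>v \<in> span S. v \<noteq> 0 \<longrightarrow> cyclic A v}"
proof -
  define \<G> where "\<G> = (\<lambda>(F, w, n). approx_cyclic F w (inverse (real (Suc n))))
    ` ({F. finite F \<and> F \<subseteq> S} \<times> D \<times> UNIV)"
  have "countable \<G>"
    unfolding \<G>_def using countable_Collect_finite_subset[OF S] D(1)
    by (intro countable_image countable_SIGMA) auto
  moreover have "openin pos_ball_sot U \<and> pos_ball_sot closure_of U = topspace pos_ball_sot" if "U \<in> \<G>" for U
    using that openin_approx_cyclic approx_cyclic_dense[OF inf] by (auto simp: \<G>_def)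
  moreover have "topspace pos_ball_sot \<inter> \<Inter>\<G> \<subseteq> {A \<in> pos_ball. \<forall>v \<in> span S. v \<noteq> 0 \<longrightarrow> cyclic A v}"
  proof
    fix A assume A: "A \<in> topspace pos_ball_sot \<inter> \<Inter>\<G>"
    have "cyclic A v" if v: "v \<in> span S" "v \<noteq> 0" for v
    proof -
      obtain F r where F: "finite F" "F \<subseteq> S" and "v = (\<Sum>x\<in>F. scale (r x) x)"
        using v(1) unfolding span_explicit by auto
      then have vF: "v \<in> span F" by (auto intro!: span_sum span_scale intro: span_base)
      show ?thesis
      proof (rule cyclic_of_approx_cyclic[OF D(2) vF v(2)])
        fix w n assume "w \<in> D"
        then have "approx_cyclic F w (inverse (real (Suc n))) \<in> \<G>" using F by (auto simp: \<G>_def)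
        then show "A \<in> approx_cyclic F w (inverse (real (Suc n)))" using A by blast
      qed
    qed
    then show "A \<in> {A \<in> pos_ball. \<forall>v \<in> span S. v \<noteq> 0 \<longrightarrow> cyclic A v}"
      using A topspace_pos_ball_sot by auto
  qed
  ultimately show ?thesis
    unfolding comeager_in_def topspace_pos_ball_sot by (intro conjI exI[of _ \<G>]) auto
qed

end

theorem theorem1:
  fixes scale :: "'k::real_or_complex \<Rightarrow> 'h::banach \<Rightarrow> 'h"
    and ip :: "'h \<Rightarrow> 'h \<Rightarrow> 'k"
    and S :: "'h set"
  assumes "hilbert_space scale ip"
    and "separable_space (euclidean :: 'h topology)"
    and "\<not> hilbert_space.finite_dim scale (UNIV :: 'h set)"
    and "countable S"
  shows "comeager_in
           (subtopology (hilbert_space.sot scale) (hilbert_space.pos_ball scale ip))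
           {A \<in> hilbert_space.pos_ball scale ip.
              \<forall>v \<in> module.span scale S. v \<noteq> 0 \<longrightarrow> hilbert_space.cyclic scale A v}"
proof -
  interpret hilbert_space scale ip by (rule assms(1))
  obtain D :: "'h set" where "countable D" "closure D = UNIV"
    using assms(2) unfolding separable_space_def by auto
  then show ?thesis using comeager_cyclic assms(3,4) by blast
qed

end
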